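(* There exists a recursive and recurrent bi-infinite word $\xi$ with decidable MSO-theory such that every nontrivial m-degree $\mathbf a$ contains some bi-infinite word $\xi_{\mathbf a}$ with $\mathsf{MTh}(\xi)=\mathsf{MTh}(\xi_{\mathbf a})$. Furthermore, $\xi_{\mathbf a}(-\infty,-1]$ and $\xi_{\mathbf a}[0,\infty)$ both belong to $\mathbf a$.
   Context: A bi-infinite word is a map $\xi\colon\mathbb Z\to\{0,1\}$, viewed as the structure $(\mathbb Z,\le,\xi^{-1}(1))$; $\mathsf{MTh}(\xi)$ is the set of monadic second-order sentences over $\{\le,P\}$ true in it. $\xi[0,\infty)$ is the $\omega$-word $\xi(0)\xi(1)\cdots$ (positions $\mathbb N$) and $\xi(-\infty,-1]$ is the $\omega^*$-word $\cdots\xi(-2)\xi(-1)$ (positions the negative integers). For degree purposes, an $\omega$-word $\alpha$ is identified with the set $\alpha^{-1}(1)\subseteq\mathbb N$, an $\omega^*$-word $\alpha$ with the set $\{-i\mid \alpha(i)=1\}\subseteq\mathbb N$, and a bi-infinite word $\xi$ with $\{2i\mid i\ge0,\xi(i)=1\}\cup\{2i+1\mid i>0,\xi(-i)=1\}$. $F(\xi)$ is the set of factors $\xi(i)\cdots\xi(j)$ ($i\le j$) plus the empty word; $\xi$ is recurrent if $F(\xi)=F(\xi(-\infty,i])=F(\xi[i,\infty))$ for all $i\in\mathbb Z$. An m-degree is an equivalence class of subsets of $\mathbb N$ under many-one equivalence; it is nontrivial if it does not consist of $\emptyset$ or of $\mathbb N$. *)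

theory Defs
  imports Main "HOL-Library.Nat_Bijection"
begin

section \<open>Recursive functions and many-one degrees\<close>

text \<open>
  \<open>recursive n f\<close>: \<open>f\<close> is a total recursive function of \<open>n\<close> arguments. Minimisation is
  only applied to regular functions, so that all functions involved are total.
  Only the values of \<open>f\<close> on lists of length \<open>n\<close> are meaningful.
\<close>

inductive recursive :: "nat \<Rightarrow> (nat list \<Rightarrow> nat) \<Rightarrow> bool" where
  zero: "recursive n (\<lambda>_. 0)"
| suc: "recursive 1 (\<lambda>xs. Suc (xs ! 0))"
| proj: "i < n \<Longrightarrow> recursive n (\<lambda>xs. xs ! i)"
| comp: "recursive (length gs) f \<Longrightarrow> \<forall>g\<in>set gs. recursive n g \<Longrightarrow>
    recursive n (\<lambda>xs. f (map (\<lambda>g. g xs) gs))"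
| prim_rec: "recursive n f \<Longrightarrow> recursive (Suc (Suc n)) g \<Longrightarrow>
    recursive (Suc n) (\<lambda>xs. rec_nat (f (tl xs)) (\<lambda>k r. g (k # r # tl xs)) (hd xs))"
| minimisation: "recursive (Suc n) f \<Longrightarrow> \<forall>xs. length xs = n \<longrightarrow> (\<exists>k. f (k # xs) = 0) \<Longrightarrow>
    recursive n (\<lambda>xs. LEAST k. f (k # xs) = 0)"

definition recursive_set :: "nat set \<Rightarrow> bool" where
  "recursive_set A \<longleftrightarrow> (\<exists>f. recursive 1 f \<and> (\<forall>n. f [n] = (if n \<in> A then 1 else 0)))"

definition many_one_reducible :: "nat set \<Rightarrow> nat set \<Rightarrow> bool" (infix "\<le>\<^sub>m" 50) where
  "A \<le>\<^sub>m B \<longleftrightarrow> (\<exists>f. recursive 1 f \<and> (\<forall>n. n \<in> A \<longleftrightarrow> f [n] \<in> B))"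

definition many_one_equiv :: "(nat set \<times> nat set) set" where
  "many_one_equiv = {(A, B). A \<le>\<^sub>m B \<and> B \<le>\<^sub>m A}"

lemma many_one_reducible_refl: "A \<le>\<^sub>m A"
  unfolding many_one_reducible_def
  using recursive.proj[of 0 1] by (intro exI[of _ "\<lambda>xs. xs ! 0"]) simp

lemma many_one_reducible_trans:
  assumes "A \<le>\<^sub>m B" "B \<le>\<^sub>m C"
  shows "A \<le>\<^sub>m C"
proof -
  from assms obtain f g where f: "recursive 1 f" "\<forall>n. n \<in> A \<longleftrightarrow> f [n] \<in> B"
    and g: "recursive 1 g" "\<forall>n. n \<in> B \<longleftrightarrow> g [n] \<in> C"
    unfolding many_one_reducible_def by blast
  have "recursive 1 (\<lambda>xs. g (map (\<lambda>h. h xs) [f]))"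
    using f(1) g(1) by (intro recursive.comp) simp_all
  then show ?thesis
    unfolding many_one_reducible_def using f(2) g(2)
    by (intro exI[of _ "\<lambda>xs. g (map (\<lambda>h. h xs) [f])"]) simp
qed

lemma equiv_many_one_equiv: "equiv UNIV many_one_equiv"
  by (rule equivI)
    (auto simp: many_one_equiv_def refl_on_def sym_def trans_def
      intro: many_one_reducible_refl many_one_reducible_trans)

definition m_degrees :: "nat set set set" where
  "m_degrees = UNIV // many_one_equiv"

definition nontrivial_m_degree :: "nat set set \<Rightarrow> bool" where
  "nontrivial_m_degree a \<longleftrightarrow> a \<in> m_degrees \<and> a \<noteq> {{}} \<and> a \<noteq> {UNIV}"

section \<open>Monadic second-order logic over \<open>{\<le>, P}\<close>\<close>

text \<open>
  First-order and set variables are two separate families, both indexed by natural numbers.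
  The remaining connectives and the universal quantifiers are definable.
\<close>

datatype mso =
    Eq nat nat
  | Le nat nat
  | InP nat
  | Mem nat nat
  | Neg mso
  | Conj mso mso
  | ExFO nat mso
  | ExSO nat mso

primrec sat :: "'a::ord set \<Rightarrow> (nat \<Rightarrow> 'a) \<Rightarrow> (nat \<Rightarrow> 'a set) \<Rightarrow> mso \<Rightarrow> bool" where
  "sat P v V (Eq x y) \<longleftrightarrow> v x = v y"
| "sat P v V (Le x y) \<longleftrightarrow> v x \<le> v y"
| "sat P v V (InP x) \<longleftrightarrow> v x \<in> P"
| "sat P v V (Mem x X) \<longleftrightarrow> v x \<in> V X"
| "sat P v V (Neg \<phi>) \<longleftrightarrow> \<not> sat P v V \<phi>"
| "sat P v V (Conj \<phi> \<psi>) \<longleftrightarrow> sat P v V \<phi> \<and> sat P v V \<psi>"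
| "sat P v V (ExFO x \<phi>) \<longleftrightarrow> (\<exists>a. sat P (v(x := a)) V \<phi>)"
| "sat P v V (ExSO X \<phi>) \<longleftrightarrow> (\<exists>A. sat P v (V(X := A)) \<phi>)"

primrec free_fo :: "mso \<Rightarrow> nat set" where
  "free_fo (Eq x y) = {x, y}"
| "free_fo (Le x y) = {x, y}"
| "free_fo (InP x) = {x}"
| "free_fo (Mem x X) = {x}"
| "free_fo (Neg \<phi>) = free_fo \<phi>"
| "free_fo (Conj \<phi> \<psi>) = free_fo \<phi> \<union> free_fo \<psi>"
| "free_fo (ExFO x \<phi>) = free_fo \<phi> - {x}"
| "free_fo (ExSO X \<phi>) = free_fo \<phi>"

primrec free_so :: "mso \<Rightarrow> nat set" where
  "free_so (Eq x y) = {}"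
| "free_so (Le x y) = {}"
| "free_so (InP x) = {}"
| "free_so (Mem x X) = {X}"
| "free_so (Neg \<phi>) = free_so \<phi>"
| "free_so (Conj \<phi> \<psi>) = free_so \<phi> \<union> free_so \<psi>"
| "free_so (ExFO x \<phi>) = free_so \<phi>"
| "free_so (ExSO X \<phi>) = free_so \<phi> - {X}"

definition sentence :: "mso \<Rightarrow> bool" where
  "sentence \<phi> \<longleftrightarrow> free_fo \<phi> = {} \<and> free_so \<phi> = {}"

text \<open>Goedel numbering, based on the Cantor pairing function.\<close>

primrec code :: "mso \<Rightarrow> nat" where
  "code (Eq x y) = prod_encode (0, prod_encode (x, y))"
| "code (Le x y) = prod_encode (1, prod_encode (x, y))"
| "code (InP x) = prod_encode (2, x)"
| "code (Mem x X) = prod_encode (3, prod_encode (x, X))"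
| "code (Neg \<phi>) = prod_encode (4, code \<phi>)"
| "code (Conj \<phi> \<psi>) = prod_encode (5, prod_encode (code \<phi>, code \<psi>))"
| "code (ExFO x \<phi>) = prod_encode (6, prod_encode (x, code \<phi>))"
| "code (ExSO X \<phi>) = prod_encode (7, prod_encode (X, code \<phi>))"

lemma inj_code: "inj code"
proof (rule injI)
  fix \<phi> \<psi> :: mso
  show "code \<phi> = code \<psi> \<Longrightarrow> \<phi> = \<psi>"
    by (induction \<phi> arbitrary: \<psi>; case_tac \<psi>) auto
qed

section \<open>Bi-infinite words\<close>

text \<open>The letters \<open>0\<close> and \<open>1\<close> are represented by \<open>False\<close> and \<open>True\<close>.\<close>

type_synonym biword = "int \<Rightarrow> bool"

definition MTh :: "biword \<Rightarrow> mso set" where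
  "MTh \<xi> = {\<phi>. sentence \<phi> \<and> (\<forall>v V. sat (\<xi> -` {True}) v V \<phi>)}"

definition decidable_MTh :: "biword \<Rightarrow> bool" where
  "decidable_MTh \<xi> \<longleftrightarrow> recursive_set (code ` MTh \<xi>)"

text \<open>
  \<open>factors \<xi> I\<close> is the set of factors of the restriction of \<open>\<xi>\<close> to the interval \<open>I\<close>; thus
  \<open>{..i}\<close> yields the factors of \<open>\<xi>(-\<infinity>,i]\<close> and \<open>{i..}\<close> those of \<open>\<xi>[i,\<infinity>)\<close>.
\<close>

definition factors :: "biword \<Rightarrow> int set \<Rightarrow> bool list set" where
  "factors \<xi> I = {map \<xi> [i..j] |i j. i \<le> j \<and> {i..j} \<subseteq> I} \<union> {[]}"

definition recurrent :: "biword \<Rightarrow> bool" where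
  "recurrent \<xi> \<longleftrightarrow>
    (\<forall>i. factors \<xi> UNIV = factors \<xi> {..i} \<and> factors \<xi> {..i} = factors \<xi> {i..})"

text \<open>The sets of natural numbers identified with \<open>\<xi>\<close>, \<open>\<xi>(-\<infinity>,-1]\<close> and \<open>\<xi>[0,\<infinity>)\<close>.\<close>

definition biword_set :: "biword \<Rightarrow> nat set" where
  "biword_set \<xi> = {2 * i |i. \<xi> (int i)} \<union> {2 * i + 1 |i. i > 0 \<and> \<xi> (- int i)}"

definition left_set :: "biword \<Rightarrow> nat set" where
  "left_set \<xi> = {nat (- i) |i. i \<le> -1 \<and> \<xi> i}"

definition right_set :: "biword \<Rightarrow> nat set" where
  "right_set \<xi> = {i. \<xi> (int i)}"

definition recursive_biword :: "biword \<Rightarrow> bool" where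
  "recursive_biword \<xi> \<longleftrightarrow> recursive_set (biword_set \<xi>)"

end

(* Call a bi-infinite word rich if every finite word occurs in it arbitrarily far to the left and to the
   right. By Shelah's composition method, the truth of a formula in a word is determined by the type of the
   word, and the types of nonempty finite words form a finite semigroup S. By Ramsey's theorem, a word
   has a type of the form f^(-omega) g e^omega with idempotents e and f; if the word is rich, e and f lie in
   the minimal ideal of S. As all idempotents of the minimal ideal are conjugate and (ab)^omega = a (ba)^omega,
   the type is e^(-omega) e^omega for any idempotent e of the minimal ideal, so all rich words have
   the same theory, and this type can be computed from the formula. It remains to see that the bits of
   any nontrivial set can be inserted sparsely into a rich word without changing its m-degree. *)

theory Submission
  imports Defs "HOL-Library.Ramsey"
begin

section \<open>Closure properties of recursive functions\<close>

text \<open>Two points decide the shape of the proof. First, the middle part between the two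
  infinite powers has to vanish. For a right minimal idempotent e, the elements m with e m = m = m e
  form a group with unit e; if z is the inverse of m, rotating the period of (m z)^omega gives
  e^omega = m e^omega. Rotation is thus the only identity for infinite products that is needed: it
  changes the idempotent, splits off e and absorbs m. Second, decidability must be uniform in the
  sentence, so the formula is an input of every operation on types. Types are therefore taken
  relative to one formula and stored as numbers, built from pairs and codes of finite sets. Products
  and infinite powers follow the structure of the formula and are recursive in its code and their
  arguments together.\<close>

definition computable :: "nat \<Rightarrow> (nat list \<Rightarrow> nat) \<Rightarrow> bool" where
  "computable n F \<longleftrightarrow> (\<exists>g. recursive n g \<and> (\<forall>xs. length xs = n \<longrightarrow> g xs = F xs))"

text \<open>\<open>recursive\<close> yields particular functions with accidental values on lists of
  other lengths. \<open>computable\<close> identifies functions that agree on lists of the right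
  length, and so permits rewriting.\<close>

lemma computable_cong:
  assumes "computable n F" "\<And>xs. length xs = n \<Longrightarrow> F xs = G xs"
  shows "computable n G"
  using assms unfolding computable_def by auto

lemma computable_comp:
  assumes F: "computable (length Gs) F" and Gs: "\<forall>G\<in>set Gs. computable n G"
  shows "computable n (\<lambda>xs. F (map (\<lambda>G. G xs) Gs))"
proof -
  obtain f where f: "recursive (length Gs) f" "\<And>xs. length xs = length Gs \<Longrightarrow> f xs = F xs"
    using F unfolding computable_def by auto
  obtain h where h: "\<And>G. G \<in> set Gs \<Longrightarrow> recursive n (h G) \<and> (\<forall>xs. length xs = n \<longrightarrow> h G xs = G xs)"
    using Gs unfolding computable_def by metis
  have "recursive n (\<lambda>xs. f (map (\<lambda>g. g xs) (map h Gs)))"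
    using f(1) h by (intro recursive.comp) auto
  moreover have "f (map (\<lambda>g. g xs) (map h Gs)) = F (map (\<lambda>G. G xs) Gs)" if "length xs = n" for xs
  proof -
    have "map (\<lambda>g. g xs) (map h Gs) = map (\<lambda>G. G xs) Gs"
      using h that by simp
    then show ?thesis using f(2)[of "map (\<lambda>g. g xs) (map h Gs)"] by (metis length_map)
  qed
  ultimately show ?thesis unfolding computable_def by blast
qed

lemma computable_comp1:
  assumes "computable 1 (\<lambda>xs. f (xs ! 0))" "computable n G"
  shows "computable n (\<lambda>xs. f (G xs))"
  using computable_comp[of "[G]" "\<lambda>xs. f (xs ! 0)" n] assms by simp

lemma computable_comp2:
  assumes "computable 2 (\<lambda>xs. f (xs ! 0) (xs ! 1))" "computable n G" "computable n H"
  shows "computable n (\<lambda>xs. f (G xs) (H xs))"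
  using computable_comp[of "[G, H]" "\<lambda>xs. f (xs ! 0) (xs ! 1)" n] assms
  by (simp add: numeral_2_eq_2)

lemma computable_proj: "i < n \<Longrightarrow> computable n (\<lambda>xs. xs ! i)"
  unfolding computable_def using recursive.proj by blast

lemma computable_Suc: "computable n G \<Longrightarrow> computable n (\<lambda>xs. Suc (G xs))"
  by (rule computable_comp1) (use recursive.suc in \<open>auto simp: computable_def\<close>)

lemma computable_const: "computable n (\<lambda>_. c)"
proof (induction c)
  case 0
  then show ?case unfolding computable_def using recursive.zero by blast
qed (rule computable_Suc)

lemma computable_rec_nat:
  assumes F: "computable n F" and G: "computable (Suc (Suc n)) G"
  shows "computable (Suc n) (\<lambda>xs. rec_nat (F (tl xs)) (\<lambda>k r. G (k # r # tl xs)) (hd xs))"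
proof -
  obtain f where f: "recursive n f" "\<And>xs. length xs = n \<Longrightarrow> f xs = F xs"
    using F unfolding computable_def by auto
  obtain g where g: "recursive (Suc (Suc n)) g" "\<And>xs. length xs = Suc (Suc n) \<Longrightarrow> g xs = G xs"
    using G unfolding computable_def by auto
  have "rec_nat (f (tl xs)) (\<lambda>k r. g (k # r # tl xs)) (hd xs) =
      rec_nat (F (tl xs)) (\<lambda>k r. G (k # r # tl xs)) (hd xs)" if "length xs = Suc n" for xs
    using that f(2) g(2) by simp
  then show ?thesis
    unfolding computable_def using recursive.prim_rec[OF f(1) g(1)] by blast
qed

lemma computable_Least:
  assumes F: "computable (Suc n) F" and ex: "\<And>xs. length xs = n \<Longrightarrow> \<exists>k. F (k # xs) = 0"
  shows "computable n (\<lambda>xs. LEAST k. F (k # xs) = 0)"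
proof -
  obtain f where f: "recursive (Suc n) f" "\<And>xs. length xs = Suc n \<Longrightarrow> f xs = F xs"
    using F unfolding computable_def by auto
  have "recursive n (\<lambda>xs. LEAST k. f (k # xs) = 0)"
    using f ex by (intro recursive.minimisation) auto
  moreover have "(LEAST k. f (k # xs) = 0) = (LEAST k. F (k # xs) = 0)" if "length xs = n" for xs
    using f(2) that by simp
  ultimately show ?thesis unfolding computable_def by blast
qed

text \<open>One parameter besides the counter is enough, since several arguments are later packed
  into one number.\<close>

lemma computable_rec_binary:
  assumes F: "computable 1 (\<lambda>xs. f (xs ! 0))"
    and G: "computable 3 (\<lambda>xs. g (xs ! 0) (xs ! 1) (xs ! 2))"
  shows "computable 2 (\<lambda>xs. rec_nat (f (xs ! 1)) (\<lambda>k r. g k r (xs ! 1)) (xs ! 0))"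
proof -
  have "computable (Suc 1) (\<lambda>xs. rec_nat (f (tl xs ! 0))
      (\<lambda>k r. g ((k # r # tl xs) ! 0) ((k # r # tl xs) ! 1) ((k # r # tl xs) ! 2)) (hd xs))"
    using computable_rec_nat[of 1 "\<lambda>xs. f (xs ! 0)" "\<lambda>xs. g (xs ! 0) (xs ! 1) (xs ! 2)"] F G
    by (simp add: numeral_3_eq_3)
  then have "computable 2 (\<lambda>xs. rec_nat (f (tl xs ! 0))
      (\<lambda>k r. g ((k # r # tl xs) ! 0) ((k # r # tl xs) ! 1) ((k # r # tl xs) ! 2)) (hd xs))"
    by (simp only: numeral_2_eq_2 One_nat_def)
  then show ?thesis
    by (rule computable_cong[OF _]) (auto simp: length_Suc_conv numeral_2_eq_2)
qed

lemma computable_add: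
  assumes "computable n F" "computable n G" shows "computable n (\<lambda>xs. F xs + G xs)"
proof -
  have "rec_nat b (\<lambda>k r. Suc r) a = a + b" for a b :: nat by (induction a) auto
  then have "computable 2 (\<lambda>xs. xs ! 0 + xs ! 1)"
    using computable_rec_binary[of "\<lambda>x. x" "\<lambda>k r x. Suc r"]
    by (simp add: computable_proj computable_Suc)
  then show ?thesis using assms by (rule computable_comp2)
qed

lemma computable_pred:
  assumes "computable n F" shows "computable n (\<lambda>xs. F xs - 1)"
proof -
  \<comment> \<open>The step function returns its index and ignores the previous value, so the
    recursion ends with the predecessor; \<open>b\<close> is the value at 0 and is set to 0
    below.\<close>
  have "rec_nat b (\<lambda>k r. k) a = (if a = 0 then b else a - 1)" for a b :: nat by (cases a) auto
  then have "computable 2 (\<lambda>xs. if xs ! 0 = 0 then xs ! 1 else xs ! 0 - 1)"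
    using computable_rec_binary[of "\<lambda>x. x" "\<lambda>k r x. k"]
    by (simp only:) (simp add: computable_proj)
  from computable_comp2[where f = "\<lambda>a b. if a = 0 then b else a - 1", OF this assms computable_const[of n 0]]
  show ?thesis by (rule computable_cong) auto
qed

lemma computable_diff:
  assumes "computable n F" "computable n G" shows "computable n (\<lambda>xs. F xs - G xs)"
proof -
  have "rec_nat b (\<lambda>k r. r - 1) a = b - a" for a b :: nat by (induction a) auto
  then have "computable 2 (\<lambda>xs. xs ! 1 - xs ! 0)"
    using computable_rec_binary[of "\<lambda>x. x" "\<lambda>k r x. r - 1"] computable_pred[OF computable_proj[of 1 3]]
    by (simp add: computable_proj)
  then show ?thesis using assms(2,1) by (rule computable_comp2)
qed

lemma computable_triangle:
  assumes "computable n F" shows "computable n (\<lambda>xs. triangle (F xs))"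
proof -
  have "rec_nat 0 (\<lambda>k r. r + Suc k) a = triangle a" for a :: nat by (induction a) auto
  then have "computable 2 (\<lambda>xs. triangle (xs ! 0))"
    using computable_rec_binary[of "\<lambda>x. 0" "\<lambda>k r x. r + Suc k"]
    by (simp add: computable_proj computable_Suc computable_add computable_const)
  from computable_comp2[where f = "\<lambda>a b. triangle a", OF this assms computable_const[of n 0]]
  show ?thesis .
qed

text \<open>Several arguments are passed to a unary function as nested Cantor pairs; the rules collected in
  \<open>rec_intros\<close> are then purely syntactic, and every binder pairs its variable with the
  previous argument.\<close>

definition pfst :: "nat \<Rightarrow> nat" where "pfst z = fst (prod_decode z)"
definition psnd :: "nat \<Rightarrow> nat" where "psnd z = snd (prod_decode z)"
abbreviation pair :: "nat \<Rightarrow> nat \<Rightarrow> nat" where "pair a b \<equiv> prod_encode (a, b)"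

lemma pfst_pair [simp]: "pfst (pair a b) = a" by (simp add: pfst_def)
lemma psnd_pair [simp]: "psnd (pair a b) = b" by (simp add: psnd_def)
lemma pair_pfst_psnd [simp]: "pair (pfst z) (psnd z) = z" by (simp add: pfst_def psnd_def)
lemma pfst_le: "pfst z \<le> z" using le_prod_encode_1[of "pfst z" "psnd z"] by simp
lemma psnd_le: "psnd z \<le> z" using le_prod_encode_2[of "psnd z" "pfst z"] by simp

lemma triangle_mono: "a \<le> b \<Longrightarrow> triangle a \<le> triangle b"
  by (induction rule: dec_induct) auto

lemma pair_mono: "a \<le> a' \<Longrightarrow> b \<le> b' \<Longrightarrow> pair a b \<le> pair a' b'"
  using triangle_mono[of "a + b" "a' + b'"] by (simp add: prod_encode_def)

lemma pair_less: "a \<le> a' \<Longrightarrow> b \<le> b' \<Longrightarrow> a < a' \<or> b < b' \<Longrightarrow> pair a b < pair a' b'"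
  using pair_mono[of a a' b b'] by (metis le_neq_implies_less less_irrefl prod.inject prod_encode_eq)

lemma psnd_less: "0 < pfst z \<Longrightarrow> psnd z < z"
proof -
  assume "0 < pfst z"
  then have "pair 0 (psnd z) < pair (pfst z) (psnd z)" by (intro pair_less) auto
  then show ?thesis using le_prod_encode_2[of "psnd z" 0] by simp
qed

text \<open>A code \<open>z\<close> lies on the diagonal \<open>w\<close> exactly if
  \<open>triangle w \<le> z < triangle (Suc w)\<close>. The truncated difference vanishes once the
  right bound holds, so minimisation finds the diagonal, that is, the sum of the components; both
  projections are computed from it.\<close>

lemma Least_triangle: "(LEAST w. Suc z - triangle (Suc w) = 0) = pfst z + psnd z"
proof (rule Least_equality)
  have z: "z = triangle (pfst z + psnd z) + pfst z"
    using pair_pfst_psnd[of z] unfolding prod_encode_def by simp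
  then show "Suc z - triangle (Suc (pfst z + psnd z)) = 0" by simp
  fix w assume "Suc z - triangle (Suc w) = 0"
  then have *: "Suc z \<le> triangle (Suc w)" by simp
  show "pfst z + psnd z \<le> w"
  proof (rule ccontr)
    assume "\<not> ?thesis"
    then have "triangle (Suc w) \<le> triangle (pfst z + psnd z)" by (intro triangle_mono) simp
    then show False using * z by linarith
  qed
qed

lemma computable_diagonal:
  assumes "computable n F" shows "computable n (\<lambda>xs. pfst (F xs) + psnd (F xs))"
proof -
  have *: "\<exists>k. Suc m - triangle (Suc k) = 0" for m
    by (rule exI[of _ m]) (induction m, auto)
  have "computable 1 (\<lambda>xs. LEAST k. Suc ((k # xs) ! 1) - triangle (Suc ((k # xs) ! 0)) = 0)"
  proof (rule computable_Least)
    show "computable (Suc 1) (\<lambda>xs. Suc (xs ! 1) - triangle (Suc (xs ! 0)))"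
      by (intro computable_diff computable_Suc computable_triangle computable_proj) auto
  qed (use * in simp)
  then have "computable 1 (\<lambda>xs. pfst (xs ! 0) + psnd (xs ! 0))"
    by (rule computable_cong) (use Least_triangle in \<open>simp del: triangle_Suc\<close>)
  then show ?thesis using assms by (rule computable_comp1)
qed

lemma computable_pfst:
  assumes "computable n F" shows "computable n (\<lambda>xs. pfst (F xs))"
proof -
  have "pfst z = z - triangle (pfst z + psnd z)" for z
    using pair_pfst_psnd[of z] unfolding prod_encode_def by simp
  then have "computable n (\<lambda>xs. F xs - triangle (pfst (F xs) + psnd (F xs))) \<longleftrightarrow> ?thesis"
    by presburger
  then show ?thesis
    by (simp add: computable_diff computable_triangle computable_diagonal assms)
qed

lemma computable_psnd:
  assumes "computable n F" shows "computable n (\<lambda>xs. psnd (F xs))"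
  using computable_diff[OF computable_diagonal[OF assms] computable_pfst[OF assms]] by simp

lemma computable_pair:
  assumes "computable n F" "computable n G" shows "computable n (\<lambda>xs. pair (F xs) (G xs))"
  unfolding prod_encode_def using assms
  by (simp add: computable_add computable_triangle)

section \<open>Recursive functions and predicates of one argument\<close>

definition Rec :: "(nat \<Rightarrow> nat) \<Rightarrow> bool" where
  "Rec f \<longleftrightarrow> computable 1 (\<lambda>xs. f (xs ! 0))"

definition RecP :: "(nat \<Rightarrow> bool) \<Rightarrow> bool" where
  "RecP P \<longleftrightarrow> Rec (\<lambda>x. of_bool (P x))"

named_theorems rec_intros

lemma Rec_iff: "Rec f \<longleftrightarrow> (\<exists>g. recursive 1 g \<and> (\<forall>x. g [x] = f x))"
  unfolding Rec_def computable_def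
  by (intro ex_cong1 conj_cong refl) (auto simp: length_Suc_conv)

lemma Rec_comp: "Rec f \<Longrightarrow> Rec g \<Longrightarrow> Rec (\<lambda>x. f (g x))"
  unfolding Rec_def using computable_comp1[of f 1 "\<lambda>xs. g (xs ! 0)"] by simp

lemma Rec_id [rec_intros]: "Rec (\<lambda>x. x)" unfolding Rec_def by (rule computable_proj) simp
lemma Rec_const [rec_intros]: "Rec (\<lambda>x. c)" unfolding Rec_def by (rule computable_const)
lemma Rec_Suc [rec_intros]: "Rec f \<Longrightarrow> Rec (\<lambda>x. Suc (f x))" unfolding Rec_def by (rule computable_Suc)
lemma Rec_add [rec_intros]: "Rec f \<Longrightarrow> Rec g \<Longrightarrow> Rec (\<lambda>x. f x + g x)"
  unfolding Rec_def by (rule computable_add)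
lemma Rec_diff [rec_intros]: "Rec f \<Longrightarrow> Rec g \<Longrightarrow> Rec (\<lambda>x. f x - g x)"
  unfolding Rec_def by (rule computable_diff)
lemma Rec_pfst [rec_intros]: "Rec f \<Longrightarrow> Rec (\<lambda>x. pfst (f x))" unfolding Rec_def by (rule computable_pfst)
lemma Rec_psnd [rec_intros]: "Rec f \<Longrightarrow> Rec (\<lambda>x. psnd (f x))" unfolding Rec_def by (rule computable_psnd)
lemma Rec_pair [rec_intros]: "Rec f \<Longrightarrow> Rec g \<Longrightarrow> Rec (\<lambda>x. pair (f x) (g x))"
  unfolding Rec_def by (rule computable_pair)

lemma Rec_comp2:
  "Rec (\<lambda>z. h (pfst z) (psnd z)) \<Longrightarrow> Rec f \<Longrightarrow> Rec g \<Longrightarrow> Rec (\<lambda>x. h (f x) (g x))"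
  using Rec_comp[OF _ Rec_pair, of "\<lambda>z. h (pfst z) (psnd z)" f g] by simp

lemma RecP_comp2:
  "RecP (\<lambda>z. P (pfst z) (psnd z)) \<Longrightarrow> Rec f \<Longrightarrow> Rec g \<Longrightarrow> RecP (\<lambda>x. P (f x) (g x))"
  unfolding RecP_def by (rule Rec_comp2[where h = "\<lambda>a b. of_bool (P a b)"])

lemma Rec_rec_nat [rec_intros]:
  assumes f: "Rec f" and h: "Rec (\<lambda>z. h (pfst z) (pfst (psnd z)) (psnd (psnd z)))" and n: "Rec n"
  shows "Rec (\<lambda>x. rec_nat (f x) (\<lambda>k r. h k r x) (n x))"
proof -
  have "computable 3 (\<lambda>xs. h (pfst (pair (xs ! 0) (pair (xs ! 1) (xs ! 2))))
      (pfst (psnd (pair (xs ! 0) (pair (xs ! 1) (xs ! 2)))))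
      (psnd (psnd (pair (xs ! 0) (pair (xs ! 1) (xs ! 2))))))"
    using h unfolding Rec_def
    by (rule computable_comp1) (intro computable_pair computable_proj; simp)
  then have "computable 3 (\<lambda>xs. h (xs ! 0) (xs ! 1) (xs ! 2))" by simp
  with f have *: "computable 2 (\<lambda>xs. rec_nat (f (xs ! 1)) (\<lambda>k r. h k r (xs ! 1)) (xs ! 0))"
    unfolding Rec_def by (rule computable_rec_binary)
  show ?thesis
    using computable_comp2[where f = "\<lambda>a b. rec_nat (f b) (\<lambda>k r. h k r b) a", OF * n[unfolded Rec_def]
        computable_proj[of 0 1]]
    unfolding Rec_def by simp
qed

lemma RecP_eq0: assumes "Rec f" shows "RecP (\<lambda>x. f x = 0)"
proof -
  have "1 - f x = of_bool (f x = 0)" for x by auto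
  then show ?thesis
    unfolding RecP_def using Rec_diff[OF Rec_const[of 1] assms] by simp
qed

lemma RecP_not [rec_intros]: assumes "RecP P" shows "RecP (\<lambda>x. \<not> P x)"
  using RecP_eq0[OF assms[unfolded RecP_def]] by simp

lemma RecP_or [rec_intros]: assumes "RecP P" "RecP Q" shows "RecP (\<lambda>x. P x \<or> Q x)"
  using RecP_not[OF RecP_eq0[OF Rec_add[OF assms[unfolded RecP_def]]]] by simp

lemma RecP_and [rec_intros]: assumes "RecP P" "RecP Q" shows "RecP (\<lambda>x. P x \<and> Q x)"
  using RecP_not[OF RecP_or[OF assms[THEN RecP_not]]] by simp

lemma RecP_imp [rec_intros]: assumes "RecP P" "RecP Q" shows "RecP (\<lambda>x. P x \<longrightarrow> Q x)"
  using RecP_or[OF RecP_not[OF assms(1)] assms(2)] by simp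

lemma RecP_const [rec_intros]: "RecP (\<lambda>x. c)"
  unfolding RecP_def by (rule Rec_const)
lemma RecP_le [rec_intros]: assumes "Rec f" "Rec g" shows "RecP (\<lambda>x. f x \<le> g x)"
  using RecP_eq0[OF Rec_diff[OF assms]] by simp

lemma RecP_less [rec_intros]: assumes "Rec f" "Rec g" shows "RecP (\<lambda>x. f x < g x)"
  using RecP_not[OF RecP_le[OF assms(2,1)]] by (simp add: not_le)

lemma RecP_eq [rec_intros]: assumes "Rec f" "Rec g" shows "RecP (\<lambda>x. f x = g x)"
  using RecP_and[OF RecP_le[OF assms] RecP_le[OF assms(2,1)]] by (simp only: order_eq_iff[symmetric])

lemma Rec_if [rec_intros]:
  assumes "RecP P" "Rec f" "Rec g" shows "Rec (\<lambda>x. if P x then f x else g x)"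
proof -
  have "rec_nat (g x) (\<lambda>k r. f x) (of_bool (P x)) = (if P x then f x else g x)" for x by simp
  moreover have "Rec (\<lambda>x. rec_nat (g x) (\<lambda>k r. f x) (of_bool (P x)))"
    using assms(1) unfolding RecP_def
    by (intro Rec_rec_nat assms(3) Rec_comp[OF assms(2)] rec_intros)
  ultimately show ?thesis by simp
qed

lemma Rec_Least [rec_intros]:
  assumes P: "RecP (\<lambda>z. P (pfst z) (psnd z))" and ex: "\<And>x. \<exists>k. P k x"
  shows "Rec (\<lambda>x. LEAST k. P k x)"
proof -
  have "Rec (\<lambda>z. of_bool (\<not> P (pfst z) (psnd z)))"
    using RecP_not[OF P] unfolding RecP_def .
  then have "computable 2 (\<lambda>xs. of_bool (\<not> P (pfst (pair (xs ! 0) (xs ! 1))) (psnd (pair (xs ! 0) (xs ! 1)))))"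
    unfolding Rec_def by (rule computable_comp1) (intro computable_pair computable_proj; simp)
  then have "computable (Suc 1) (\<lambda>xs. of_bool (\<not> P (xs ! 0) (xs ! 1)))"
    by (simp add: numeral_2_eq_2)
  then have "computable 1 (\<lambda>xs. LEAST k. of_bool (\<not> P ((k # xs) ! 0) ((k # xs) ! 1)) = (0::nat))"
    by (rule computable_Least) (use ex in simp)
  then show ?thesis unfolding Rec_def by simp
qed

lemma RecP_all_less [rec_intros]:
  assumes P: "RecP (\<lambda>z. P (pfst z) (psnd z))" and n: "Rec n"
  shows "RecP (\<lambda>x. \<forall>k<n x. P k x)"
proof -
  have "rec_nat (1::nat) (\<lambda>k r. of_bool (r \<noteq> 0 \<and> P k x)) m = of_bool (\<forall>k<m. P k x)" for m x
    by (induction m) (auto simp: less_Suc_eq)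
  moreover have "RecP (\<lambda>z. P (pfst z) (psnd (psnd z)))"
    by (rule RecP_comp2[OF P]) (intro rec_intros)+
  then have "Rec (\<lambda>x. rec_nat 1 (\<lambda>k r. of_bool (r \<noteq> 0 \<and> P k x)) (n x))"
    by (intro Rec_rec_nat n rec_intros, fold RecP_def) (intro rec_intros)
  ultimately show ?thesis unfolding RecP_def by (simp only:)
qed

lemma Rec_half [rec_intros]: assumes "Rec f" shows "Rec (\<lambda>x. f x div 2)"
proof -
  \<comment> \<open>Halving by search, because only sums and comparisons are at hand.\<close>
  have "(LEAST h. n \<le> h + h + 1) = n div 2" for n :: nat
    by (rule Least_equality) auto
  moreover have "Rec (\<lambda>n. LEAST h. n \<le> h + h + 1)"
    by (intro rec_intros) presburger
  ultimately show ?thesis using Rec_comp[OF _ assms] by simp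
qed

lemma RecP_odd [rec_intros]: assumes "Rec f" shows "RecP (\<lambda>x. odd (f x))"
proof -
  have "odd n \<longleftrightarrow> n \<noteq> n div 2 + n div 2" for n :: nat by presburger
  then show ?thesis using assms by (simp only:) (intro rec_intros)
qed

section \<open>Finite sets coded as numbers\<close>

lemma RecP_mem [rec_intros]: assumes "Rec f" "Rec g" shows "RecP (\<lambda>x. f x \<in> set_decode (g x))"
proof -
  have "rec_nat n (\<lambda>k r. r div 2) k = n div 2 ^ k" for n k :: nat
    by (induction k) (auto simp: div_mult2_eq[symmetric] mult.commute)
  then have *: "k \<in> set_decode n \<longleftrightarrow> odd (rec_nat n (\<lambda>k r. r div 2) k)" for n k :: nat
    by (simp add: set_decode_def)
  show ?thesis unfolding * using assms by (intro rec_intros)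
qed

lemma Rec_power [rec_intros]: assumes "Rec f" shows "Rec (\<lambda>x. 2 ^ f x)"
proof -
  have "rec_nat 1 (\<lambda>k r. r + r) n = (2::nat) ^ n" for n by (induction n) auto
  moreover have "Rec (\<lambda>x. rec_nat 1 (\<lambda>k r. r + r) (f x))" using assms by (intro rec_intros)
  ultimately show ?thesis by simp
qed

lemma set_decode_less: "k \<in> set_decode n \<Longrightarrow> k < n"
proof -
  assume "k \<in> set_decode n"
  then have "n div 2 ^ k \<noteq> 0" unfolding set_decode_def by (intro notI) simp
  then have "2 ^ k \<le> n" by (metis div_less not_le)
  then show ?thesis using less_exp[of k] by linarith
qed

text \<open>Codes grow with inclusion. A finite set can therefore be computed from a test of
  inclusion alone, by minimisation over its supersets.\<close>

lemma set_encode_Least: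
  assumes "finite A" shows "(LEAST Z. A \<subseteq> set_decode Z) = set_encode A"
  by (rule Least_equality) (use assms subset_decode_imp_le in auto)

lemma RecP_ball [rec_intros]:
  assumes P: "RecP (\<lambda>z. P (pfst z) (psnd z))" and n: "Rec n"
  shows "RecP (\<lambda>x. \<forall>k\<in>set_decode (n x). P k x)"
proof -
  have "(\<forall>k\<in>set_decode (n x). P k x) \<longleftrightarrow> (\<forall>k<n x. k \<in> set_decode (n x) \<longrightarrow> P k x)" for x
    using set_decode_less by auto
  moreover have "RecP (\<lambda>x. \<forall>k<n x. k \<in> set_decode (n x) \<longrightarrow> P k x)"
    by (intro rec_intros P n Rec_comp[OF n])
  ultimately show ?thesis by simp
qed

lemma RecP_bex [rec_intros]:
  assumes "RecP (\<lambda>z. P (pfst z) (psnd z))" and "Rec n"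
  shows "RecP (\<lambda>x. \<exists>k\<in>set_decode (n x). P k x)"
  using RecP_not[OF RecP_ball[OF RecP_not[OF assms(1)] assms(2)]] by simp

lemma Rec_set_encode:
  assumes "RecP (\<lambda>z. A (psnd z) \<subseteq> set_decode (pfst z))" "\<And>x. finite (A x)"
  shows "Rec (\<lambda>x. set_encode (A x))"
proof -
  have "Rec (\<lambda>x. LEAST Z. A x \<subseteq> set_decode Z)"
    using assms by (intro Rec_Least) (auto intro: exI[of _ "set_encode (A _)"])
  then show ?thesis by (simp add: set_encode_Least assms(2))
qed

text \<open>The shape is that of the quantifier clauses of \<open>mul\<close> and
  \<open>omega\<close>; the filter \<open>P\<close> is there for the idempotents in the
  latter.\<close>

lemma Rec_set_encode_products [rec_intros]:
  assumes h: "Rec (\<lambda>z. h (pfst z) (pfst (psnd z)) (psnd (psnd z)))"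
    and P: "RecP (\<lambda>z. P (pfst z) (pfst (psnd z)) (psnd (psnd z)))"
    and m: "Rec m" and n: "Rec n"
  shows "Rec (\<lambda>x. set_encode {h a b x |a b. a \<in> set_decode (m x) \<and> b \<in> set_decode (n x) \<and> P a b x})"
proof (rule Rec_set_encode)
  have h': "Rec (\<lambda>z. h (f z) (g z) (k z))" if "Rec f" "Rec g" "Rec k" for f g k
    using Rec_comp[OF h, of "\<lambda>z. pair (f z) (pair (g z) (k z))"] that by (simp add: rec_intros)
  have P': "RecP (\<lambda>z. P (f z) (g z) (k z))" if "Rec f" "Rec g" "Rec k" for f g k
    using Rec_comp[OF P[unfolded RecP_def], of "\<lambda>z. pair (f z) (pair (g z) (k z))"] that
    unfolding RecP_def by (simp add: rec_intros)
  have "{h a b x |a b. a \<in> set_decode (m x) \<and> b \<in> set_decode (n x) \<and> P a b x} \<subseteq> set_decode Z \<longleftrightarrow>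
      (\<forall>a\<in>set_decode (m x). \<forall>b\<in>set_decode (n x). P a b x \<longrightarrow> h a b x \<in> set_decode Z)" for x Z
    by auto
  then show "RecP (\<lambda>z. {h a b (psnd z) |a b. a \<in> set_decode (m (psnd z)) \<and> b \<in> set_decode (n (psnd z))
      \<and> P a b (psnd z)} \<subseteq> set_decode (pfst z))"
    by (simp only:) (intro rec_intros h' P' Rec_comp[OF m] Rec_comp[OF n])
  fix x
  have "{h a b x |a b. a \<in> set_decode (m x) \<and> b \<in> set_decode (n x) \<and> P a b x} \<subseteq>
      (\<lambda>(a, b). h a b x) ` (set_decode (m x) \<times> set_decode (n x))" by auto
  then show "finite {h a b x |a b. a \<in> set_decode (m x) \<and> b \<in> set_decode (n x) \<and> P a b x}"
    by (rule finite_subset) simp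
qed

lemma Rec_union [rec_intros]:
  assumes "Rec f" "Rec g" shows "Rec (\<lambda>x. set_encode (set_decode (f x) \<union> set_decode (g x)))"
proof (rule Rec_set_encode)
  have "RecP (\<lambda>z. (\<forall>a\<in>set_decode (f (psnd z)). a \<in> set_decode (pfst z)) \<and>
      (\<forall>a\<in>set_decode (g (psnd z)). a \<in> set_decode (pfst z)))"
    by (intro rec_intros Rec_comp[OF assms(1)] Rec_comp[OF assms(2)])
  then show "RecP (\<lambda>z. set_decode (f (psnd z)) \<union> set_decode (g (psnd z)) \<subseteq> set_decode (pfst z))"
    by (simp only: subset_eq ball_Un)
qed auto

lemma Rec_remove [rec_intros]:
  assumes "Rec f" "Rec g" shows "Rec (\<lambda>x. set_encode (set_decode (f x) - {g x}))"
proof (rule Rec_set_encode)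
  have "RecP (\<lambda>z. \<forall>a\<in>set_decode (f (psnd z)). a \<noteq> g (psnd z) \<longrightarrow> a \<in> set_decode (pfst z))"
    by (intro rec_intros Rec_comp[OF assms(1)] Rec_comp[OF assms(2)])
  moreover have "(set_decode (f (psnd z)) - {g (psnd z)} \<subseteq> set_decode (pfst z)) \<longleftrightarrow>
     (\<forall>a\<in>set_decode (f (psnd z)). a \<noteq> g (psnd z) \<longrightarrow> a \<in> set_decode (pfst z))" for z by auto
  ultimately show "RecP (\<lambda>z. set_decode (f (psnd z)) - {g (psnd z)} \<subseteq> set_decode (pfst z))"
    by simp
qed auto

lemma Rec_insert [rec_intros]:
  assumes "Rec f" "Rec g" shows "Rec (\<lambda>x. set_encode (insert (g x) (set_decode (f x))))"
proof -
  have "set_decode (2 ^ a) = {a}" for a using set_encode_inverse[of "{a}"] by (simp del: set_encode_inverse)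
  then have "insert (g x) (set_decode (f x)) = set_decode (2 ^ g x) \<union> set_decode (f x)" for x by simp
  then show ?thesis using assms by (simp only:) (intro rec_intros)
qed

text \<open>The disjunct \<open>T \<le> v\<close> only makes the minimisation total: all pairs in the table are below \<open>T\<close>.\<close>

definition lookup :: "nat \<Rightarrow> nat \<Rightarrow> nat" where
  "lookup T y = (LEAST v. pair y v \<in> set_decode T \<or> T \<le> v)"

lemma Rec_lookup [rec_intros]: "Rec f \<Longrightarrow> Rec g \<Longrightarrow> Rec (\<lambda>x. lookup (f x) (g x))"
proof (rule Rec_comp2[where h = lookup])
  show "Rec (\<lambda>z. lookup (pfst z) (psnd z))" unfolding lookup_def by (intro rec_intros) auto
qed

text \<open>The table of the values of \<open>f\<close> at all arguments of rank below \<open>k\<close> is computed by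
  primitive recursion on \<open>k\<close>.\<close>

theorem Rec_wf:
  assumes r: "Rec r" "\<And>y. y \<le> r y"
    and \<Phi>: "Rec (\<lambda>z. \<Phi> (pfst z) (psnd z))"
    and eq: "\<And>x T. (\<And>y. r y < r x \<Longrightarrow> lookup T y = f y) \<Longrightarrow> f x = \<Phi> x T"
  shows "Rec f"
proof -
  define A where "A k = {pair y (f y) |y. r y < k}" for k
  define tab where "tab = (\<lambda>k. set_encode (A k))"
  \<comment> \<open>Because of \<open>y \<le> r y\<close>, all arguments of rank below
    \<open>k\<close> are themselves below \<open>k\<close>.\<close>
  have fin: "finite (A k)" for k
  proof -
    have "{y. r y < k} \<subseteq> {..<k}" using r(2) by (auto intro: le_less_trans)
    then have "finite {y. r y < k}" by (rule finite_subset) simp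
    then show ?thesis unfolding A_def by auto
  qed
  have look: "lookup (tab k) y = f y" if "r y < k" for k y
    unfolding lookup_def
  proof (rule Least_equality)
    have mem: "pair y (f y) \<in> set_decode (tab k)" using fin that by (auto simp: tab_def A_def)
    then show "pair y (f y) \<in> set_decode (tab k) \<or> tab k \<le> f y" by simp
    fix v assume "pair y v \<in> set_decode (tab k) \<or> tab k \<le> v"
    then show "f y \<le> v"
    proof
      assume "pair y v \<in> set_decode (tab k)"
      then show ?thesis using fin by (auto simp: tab_def A_def)
    next
      assume "tab k \<le> v"
      then show ?thesis using set_decode_less[OF mem] le_prod_encode_2[of "f y" y] by simp
    qed
  qed
  have step: "f y = \<Phi> y (tab (r y))" for y
    by (rule eq) (rule look)
  \<comment> \<open>One round adds the arguments of rank exactly \<open>k\<close>; the bound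
    \<open>y < Suc k\<close>, again from \<open>y \<le> r y\<close>, keeps the search for them
    finite.\<close>
  define B where "B k T = set_decode T \<union> {pair y (\<Phi> y T) |y. y < Suc k \<and> r y = k}" for k T
  have "A (Suc k) = B k (tab k)" for k
  proof -
    have "A (Suc k) = A k \<union> {pair y (f y) |y. y < Suc k \<and> r y = k}"
      using r(2) unfolding A_def by (auto simp: less_Suc_eq_le le_less)
    moreover have "f y = \<Phi> y (tab k)" if "r y = k" for y
      using step[of y] that by simp
    then have "{pair y (f y) |y. y < Suc k \<and> r y = k} = {pair y (\<Phi> y (tab k)) |y. y < Suc k \<and> r y = k}"
      by auto
    ultimately show ?thesis unfolding B_def by (simp add: tab_def fin)
  qed
  then have tabS: "tab (Suc k) = set_encode (B k (tab k))" for k by (simp add: tab_def)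
  have tab0: "tab 0 = 0" by (simp add: tab_def A_def)
  have "tab k = rec_nat 0 (\<lambda>k T. set_encode (B k T)) k" for k
    by (induction k) (auto simp: tab0 tabS)
  moreover have "Rec (\<lambda>x. rec_nat 0 (\<lambda>k T. set_encode (B k T)) (r x))"
  proof (intro rec_intros r)
    have \<Phi>': "Rec (\<lambda>z. \<Phi> (f z) (g z))" if "Rec f" "Rec g" for f g
      by (rule Rec_comp2[OF \<Phi> that])
    have "B k T \<subseteq> set_decode Z \<longleftrightarrow> (\<forall>u\<in>set_decode T. u \<in> set_decode Z) \<and>
        (\<forall>y<Suc k. r y = k \<longrightarrow> pair y (\<Phi> y T) \<in> set_decode Z)" for k T Z
      unfolding B_def by auto
    then show "Rec (\<lambda>z. set_encode (B (pfst z) (pfst (psnd z))))"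
      by (intro Rec_set_encode) (simp only:, intro rec_intros \<Phi>' Rec_comp[OF r(1)], auto simp: B_def)
  qed
  ultimately have "Rec (\<lambda>x. tab (r x))" by simp
  then have "Rec (\<lambda>x. \<Phi> x (tab (r x)))" by (intro Rec_comp2[OF \<Phi>] rec_intros)
  then show ?thesis by (simp only: step[symmetric])
qed

section \<open>The composition method\<close>

text \<open>All variables are set variables. The first argument \<open>k\<close> of \<open>At k i j\<close> selects what is asserted:
  the sets \<open>i\<close> and \<open>j\<close> meet (\<open>0\<close>); some element of \<open>i\<close> is at most some element of \<open>j\<close> (\<open>1\<close>);
  they meet and no element of \<open>i\<close> is below one of \<open>j\<close> (\<open>2\<close>), which for \<open>i = j\<close> says
  that the set is a singleton.\<close>

datatype fm = At nat nat nat | NotF fm | AndF fm fm | ExF nat fm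

text \<open>Bits 2 and 3 are what \<open>accepts\<close> reads. Bits 0 and 1 are carried along to
  compute bit 3 of a concatenation, where \<open>x\<close> may come from the first part and
  \<open>y\<close> from the second.\<close>

definition atom :: "int set \<Rightarrow> int set \<Rightarrow> int set \<Rightarrow> nat set" where
  "atom I X Y = {b. b = 0 \<and> (\<exists>x\<in>I. x \<in> X) \<or> b = 1 \<and> (\<exists>y\<in>I. y \<in> Y) \<or>
    b = 2 \<and> (\<exists>x\<in>I. x \<in> X \<and> x \<in> Y) \<or> b = 3 \<and> (\<exists>x\<in>I. \<exists>y\<in>I. x \<in> X \<and> y \<in> Y \<and> x < y)}"

text \<open>The type of a coloured segment \<open>I\<close> of the integers with respect to a formula. It depends neither on
  negations nor on the truth value of the formula, which is only read off by \<open>accepts\<close>; hence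
  \<open>mul\<close> and \<open>omega\<close> depend on the shape of the formula alone.\<close>

primrec wtype :: "fm \<Rightarrow> int set \<Rightarrow> (nat \<Rightarrow> int set) \<Rightarrow> nat" where
  "wtype (At k i j) I V = set_encode (atom I (V i) (V j))"
| "wtype (NotF \<phi>) I V = wtype \<phi> I V"
| "wtype (AndF \<phi> \<psi>) I V = pair (wtype \<phi> I V) (wtype \<psi> I V)"
| "wtype (ExF i \<phi>) I V = set_encode (range (\<lambda>B. wtype \<phi> I (V(i := B))))"

text \<open>Pairs split by the cut contribute to bit 3 only. Under a quantifier, choosing a set on
  two adjacent segments amounts to independent choices on each, hence the complex product.\<close>

primrec mul :: "fm \<Rightarrow> nat \<Rightarrow> nat \<Rightarrow> nat" where
  "mul (At k i j) s t = set_encode (set_decode s \<union> set_decode t \<union>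
    (if 0 \<in> set_decode s \<and> 1 \<in> set_decode t then {3} else {}))"
| "mul (NotF \<phi>) s t = mul \<phi> s t"
| "mul (AndF \<phi> \<psi>) s t = pair (mul \<phi> (pfst s) (pfst t)) (mul \<psi> (psnd s) (psnd t))"
| "mul (ExF i \<phi>) s t = set_encode {mul \<phi> a b |a b. a \<in> set_decode s \<and> b \<in> set_decode t}"

text \<open>The first factor is the one nearer to the origin. With the direction \<open>d\<close> as
  a parameter, one proof covers both half-lines.\<close>

definition mulD :: "bool \<Rightarrow> fm \<Rightarrow> nat \<Rightarrow> nat \<Rightarrow> nat" where
  "mulD d \<phi> s t = (if d then mul \<phi> s t else mul \<phi> t s)"

text \<open>The type of an \<open>\<omega>\<close>-sequence (\<open>d = True\<close>) or \<open>\<omega>\<^sup>*\<close>-sequence (\<open>d = False\<close>) of segments of the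
  same idempotent type. In the case of a quantifier, Ramsey's theorem reduces every choice of a set to a prefix
  followed by segments of a common idempotent type.\<close>

primrec omega :: "bool \<Rightarrow> fm \<Rightarrow> nat \<Rightarrow> nat" where
  "omega d (At k i j) e = e"
| "omega d (NotF \<phi>) e = omega d \<phi> e"
| "omega d (AndF \<phi> \<psi>) e = pair (omega d \<phi> (pfst e)) (omega d \<psi> (psnd e))"
| "omega d (ExF i \<phi>) e = set_encode {mulD d \<phi> s (omega d \<phi> f) |s f.
    s \<in> set_decode e \<and> f \<in> set_decode e \<and> mul \<phi> f f = f}"

section \<open>Finiteness and associativity of types\<close>

lemma finite_atom [simp]: "finite (atom I X Y)"
  by (rule finite_subset[of _ "{0, 1, 2, 3}"]) (auto simp: atom_def)

lemma atom_0: "0 \<in> atom I X Y \<longleftrightarrow> (\<exists>x\<in>I. x \<in> X)"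
  and atom_1: "1 \<in> atom I X Y \<longleftrightarrow> (\<exists>y\<in>I. y \<in> Y)"
  and atom_2: "2 \<in> atom I X Y \<longleftrightarrow> (\<exists>x\<in>I. x \<in> X \<and> x \<in> Y)"
  and atom_3: "3 \<in> atom I X Y \<longleftrightarrow> (\<exists>x\<in>I. \<exists>y\<in>I. x \<in> X \<and> y \<in> Y \<and> x < y)"
  by (simp_all add: atom_def)

text \<open>Four bits at an atom, then products and power sets of finite sets. This bounds the
  colours for Ramsey's theorem and makes \<open>set_encode\<close> invertible on the types of
  quantified formulas.\<close>

lemma finite_types: "finite (range (\<lambda>(I, V). wtype \<phi> I V))"
proof (induction \<phi>)
  case (At k i j)
  have "atom I X Y \<subseteq> {..3}" for I X Y by (auto simp: atom_def)
  then have "range (\<lambda>(I, V). wtype (At k i j) I V) \<subseteq> set_encode ` Pow {..3}" by auto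
  then show ?case by (rule finite_subset) simp
next
  case (AndF \<phi> \<psi>)
  have "range (\<lambda>(I, V). wtype (AndF \<phi> \<psi>) I V) \<subseteq>
      prod_encode ` (range (\<lambda>(I, V). wtype \<phi> I V) \<times> range (\<lambda>(I, V). wtype \<psi> I V))" by auto
  then show ?case by (rule finite_subset) (intro finite_imageI finite_cartesian_product AndF)
next
  case (ExF i \<phi>)
  have "range (\<lambda>(I, V). wtype (ExF i \<phi>) I V) \<subseteq> set_encode ` Pow (range (\<lambda>(I, V). wtype \<phi> I V))" by auto
  then show ?case by (rule finite_subset) (intro finite_imageI finite_Pow_iff[THEN iffD2] ExF)
qed simp

lemma finite_wtype_ex [simp]: "finite (range (\<lambda>B. wtype \<phi> I (V(i := B))))"
  by (rule finite_subset[OF _ finite_types[of \<phi>]]) auto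

lemma finite_mul_ex [simp]: "finite {mul \<phi> a b |a b. a \<in> set_decode s \<and> b \<in> set_decode t}"
proof -
  have "{mul \<phi> a b |a b. a \<in> set_decode s \<and> b \<in> set_decode t} =
      (\<lambda>(a, b). mul \<phi> a b) ` (set_decode s \<times> set_decode t)" by auto
  then show ?thesis by simp
qed

lemma finite_omega_ex [simp]: "finite {mulD d \<phi> s (omega d \<phi> f) |s f.
    s \<in> set_decode e \<and> f \<in> set_decode e \<and> mul \<phi> f f = f}"
proof -
  have "{mulD d \<phi> s (omega d \<phi> f) |s f. s \<in> set_decode e \<and> f \<in> set_decode e \<and> mul \<phi> f f = f} \<subseteq>
      (\<lambda>(s, f). mulD d \<phi> s (omega d \<phi> f)) ` (set_decode e \<times> set_decode e)" by auto
  then show ?thesis by (rule finite_subset) simp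
qed

text \<open>Valid for all numbers, not only for types, because every number decodes to a finite set
  and to a pair; later computations may rebracket freely.\<close>

lemma mul_assoc: "mul \<phi> (mul \<phi> s t) u = mul \<phi> s (mul \<phi> t u)"
proof (induction \<phi> arbitrary: s t u)
  case (At k i j)
  show ?case by (simp only: mul.simps, rule arg_cong[where f = set_encode]) auto
next
  case (ExF i \<phi>)
  have "{mul \<phi> x c |x c. x \<in> {mul \<phi> a b |a b. a \<in> S \<and> b \<in> T} \<and> c \<in> U} =
      {mul \<phi> a x |a x. a \<in> S \<and> x \<in> {mul \<phi> b c |b c. b \<in> T \<and> c \<in> U}}" (is "?L = ?R") for S T U
  proof (intro equalityI subsetI)
    fix u assume "u \<in> ?L"
    then obtain a b c where "a \<in> S" "b \<in> T" "c \<in> U" "u = mul \<phi> (mul \<phi> a b) c" by blast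
    then show "u \<in> ?R" unfolding ExF by blast
  next
    fix u assume "u \<in> ?R"
    then obtain a b c where "a \<in> S" "b \<in> T" "c \<in> U" "u = mul \<phi> a (mul \<phi> b c)" by blast
    then show "u \<in> ?L" unfolding ExF[symmetric] by blast
  qed
  then show ?case by simp
qed auto

lemma atom_Int: "atom I (X \<inter> I) (Y \<inter> I) = atom I X Y"
  unfolding atom_def by (simp cong: bex_cong)

lemma wtype_cong: "(\<And>i. V i \<inter> I = W i \<inter> I) \<Longrightarrow> wtype \<phi> I V = wtype \<phi> I W"
proof (induction \<phi> arbitrary: V W)
  case (At k i j)
  have "atom I (V i) (V j) = atom I (V i \<inter> I) (V j \<inter> I)" by (simp only: atom_Int)
  also have "\<dots> = atom I (W i) (W j)" by (simp only: At atom_Int)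
  finally have "atom I (V i) (V j) = atom I (W i) (W j)" .
  then show ?case by (simp only: wtype.simps)
next
  case (NotF \<phi>)
  show ?case using NotF.IH[OF NotF.prems] by (simp only: wtype.simps)
next
  case (AndF \<phi> \<psi>)
  show ?case using AndF.IH(1)[OF AndF.prems] AndF.IH(2)[OF AndF.prems] by (simp only: wtype.simps)
next
  case (ExF i \<phi>)
  have "wtype \<phi> I (V(i := B)) = wtype \<phi> I (W(i := B))" for B
    by (rule ExF.IH) (simp add: ExF.prems)
  then show ?case by (simp only: wtype.simps)
qed

definition before :: "bool \<Rightarrow> int set \<Rightarrow> int set \<Rightarrow> bool" where
  "before d I J \<longleftrightarrow> (\<forall>x\<in>I. \<forall>y\<in>J. if d then x < y else y < x)"

lemma wtype_Un_forward:
  assumes "before True I J"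
  shows "wtype \<phi> (I \<union> J) V = mul \<phi> (wtype \<phi> I V) (wtype \<phi> J V)"
proof (induction \<phi> arbitrary: V)
  case (At k i j)
  have less: "x < y" "\<not> y < x" if "x \<in> I" "y \<in> J" for x y
    using assms that unfolding before_def by force+
  have "atom (I \<union> J) X Y = atom I X Y \<union> atom J X Y \<union>
      (if 0 \<in> atom I X Y \<and> 1 \<in> atom J X Y then {3} else {})" for X Y
  proof (intro set_eqI)
    fix b :: nat
    consider "b = 0" | "b = 1" | "b = 2" | "b = 3" | "b \<notin> {0, 1, 2, 3}" by auto
    then show "b \<in> atom (I \<union> J) X Y \<longleftrightarrow> b \<in> atom I X Y \<union> atom J X Y \<union>
      (if 0 \<in> atom I X Y \<and> 1 \<in> atom J X Y then {3} else {})"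
    proof cases
      case 4
      have "3 \<in> atom (I \<union> J) X Y \<longleftrightarrow>
          3 \<in> atom I X Y \<or> 3 \<in> atom J X Y \<or> 0 \<in> atom I X Y \<and> 1 \<in> atom J X Y"
        unfolding atom_3 atom_0 atom_1
      proof
        assume "\<exists>x\<in>I \<union> J. \<exists>y\<in>I \<union> J. x \<in> X \<and> y \<in> Y \<and> x < y"
        then obtain x y where xy: "x \<in> I \<union> J" "y \<in> I \<union> J" "x \<in> X" "y \<in> Y" "x < y" by blast
        then have "x \<in> I \<or> y \<in> J" using less(2) by blast
        then show "(\<exists>x\<in>I. \<exists>y\<in>I. x \<in> X \<and> y \<in> Y \<and> x < y) \<or>
            (\<exists>x\<in>J. \<exists>y\<in>J. x \<in> X \<and> y \<in> Y \<and> x < y) \<or> (\<exists>x\<in>I. x \<in> X) \<and> (\<exists>y\<in>J. y \<in> Y)"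
          using xy by blast
      next
        assume "(\<exists>x\<in>I. \<exists>y\<in>I. x \<in> X \<and> y \<in> Y \<and> x < y) \<or>
            (\<exists>x\<in>J. \<exists>y\<in>J. x \<in> X \<and> y \<in> Y \<and> x < y) \<or> (\<exists>x\<in>I. x \<in> X) \<and> (\<exists>y\<in>J. y \<in> Y)"
        then show "\<exists>x\<in>I \<union> J. \<exists>y\<in>I \<union> J. x \<in> X \<and> y \<in> Y \<and> x < y"
        proof (elim disjE conjE bexE)
          fix x y assume "x \<in> I" "y \<in> J" "x \<in> X" "y \<in> Y"
          then show ?thesis using less(1)[of x y] by blast
        qed blast+
      qed
      then show ?thesis using 4 by (simp del: One_nat_def) blast
    next
      case 5
      then have "b \<notin> atom A X Y" for A unfolding atom_def by simp
      then show ?thesis using 5 by simp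
    qed (simp_all add: atom_0 atom_1 atom_2 bex_Un del: One_nat_def)
  qed
  then show ?case by simp
next
  case (ExF i \<phi>)
  have disj: "I \<inter> J = {}" using assms unfolding before_def by auto
  have ex: "\<exists>C. mul \<phi> (wtype \<phi> I (V(i := A))) (wtype \<phi> J (V(i := B))) = wtype \<phi> (I \<union> J) (V(i := C))" for A B
  proof
    \<comment> \<open>The two choices are glued along the disjoint segments; by
      \<open>wtype_cong\<close> neither side notices the other.\<close>
    let ?C = "(A \<inter> I) \<union> (B \<inter> J)"
    have "wtype \<phi> I (V(i := ?C)) = wtype \<phi> I (V(i := A))" "wtype \<phi> J (V(i := ?C)) = wtype \<phi> J (V(i := B))"
      by (rule wtype_cong, use disj in auto)+
    then show "mul \<phi> (wtype \<phi> I (V(i := A))) (wtype \<phi> J (V(i := B))) = wtype \<phi> (I \<union> J) (V(i := ?C))"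
      by (simp only: ExF)
  qed
  have "range (\<lambda>C. wtype \<phi> (I \<union> J) (V(i := C))) =
      {mul \<phi> a b |a b. a \<in> range (\<lambda>A. wtype \<phi> I (V(i := A))) \<and> b \<in> range (\<lambda>B. wtype \<phi> J (V(i := B)))}"
    (is "?L = ?R")
  proof (intro equalityI subsetI)
    fix u assume "u \<in> ?L"
    then obtain C where "u = wtype \<phi> (I \<union> J) (V(i := C))" by blast
    then show "u \<in> ?R" unfolding ExF by blast
  next
    fix u assume "u \<in> ?R"
    then obtain A B where "u = mul \<phi> (wtype \<phi> I (V(i := A))) (wtype \<phi> J (V(i := B)))" by blast
    then show "u \<in> ?L" using ex[of A B] by (auto simp del: fun_upd_apply)
  qed
  then show ?case by simp
qed auto

lemma wtype_Un: "before d I J \<Longrightarrow> wtype \<phi> (I \<union> J) V = mulD d \<phi> (wtype \<phi> I V) (wtype \<phi> J V)"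
  using wtype_Un_forward[of I J] wtype_Un_forward[of J I]
  by (auto simp: before_def mulD_def Un_commute)

section \<open>Infinite products of segments\<close>

definition ordered :: "bool \<Rightarrow> (nat \<Rightarrow> int set) \<Rightarrow> bool" where
  "ordered d I \<longleftrightarrow> (\<forall>i j. i < j \<longrightarrow> before d (I i) (I j))"

lemma orderedD: "ordered d I \<Longrightarrow> i < j \<Longrightarrow> before d (I i) (I j)"
  unfolding ordered_def by simp

definition seg :: "(nat \<Rightarrow> int set) \<Rightarrow> nat \<Rightarrow> nat \<Rightarrow> int set" where
  "seg I m n = (\<Union>k\<in>{m..<n}. I k)"

lemma seg_Un: "l \<le> m \<Longrightarrow> m \<le> n \<Longrightarrow> seg I l m \<union> seg I m n = seg I l n"
  unfolding seg_def by (simp only: UN_Un[symmetric] ivl_disj_un_two(3))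

lemma before_seg:
  assumes "ordered d I" "n \<le> l"
  shows "before d (seg I m n) (seg I l k)"
  unfolding before_def seg_def
proof (intro ballI)
  fix x y assume "x \<in> (\<Union>k\<in>{m..<n}. I k)" "y \<in> (\<Union>k\<in>{l..<k}. I k)"
  then obtain i j where "i < n" "l \<le> j" "x \<in> I i" "y \<in> I j" by auto
  then show "if d then x < y else y < x"
    using orderedD[OF assms(1), of i j] assms(2) unfolding before_def by auto
qed

lemma UN_seg:
  assumes "strict_mono n"
  shows "(\<Union>k. I k) = seg I 0 (n 0) \<union> (\<Union>j. seg I (n j) (n (Suc j)))"
proof -
  have "k \<in> {n 0..<n j} \<Longrightarrow> \<exists>i. n i \<le> k \<and> k < n (Suc i)" for k j
  proof (induction j)
    case (Suc j)
    then show ?case by (cases "k < n j") (auto simp: not_less)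
  qed simp
  moreover have "k < n (Suc k)" for k using assms strict_mono_imp_increasing[of n "Suc k"] by simp
  ultimately have "k < n 0 \<or> (\<exists>i. n i \<le> k \<and> k < n (Suc i))" for k
    by (cases "k < n 0") (auto simp: not_less)
  then have "k \<in> {0..<n 0} \<union> (\<Union>j. {n j..<n (Suc j)})" for k
    by (simp only: Un_iff UN_iff atLeastLessThan_iff UNIV_I le0 simp_thms Bex_def)
  then have UNIV: "UNIV = {0..<n 0} \<union> (\<Union>j. {n j..<n (Suc j)})"
    by (rule UNIV_eq_I)
  show ?thesis unfolding seg_def by (subst UNIV) (simp only: UN_Un UN_UN_flatten)
qed

lemma wtype_seg_Un:
  assumes "ordered d I" "l \<le> m" "m \<le> n"
  shows "wtype \<phi> (seg I l n) V = mulD d \<phi> (wtype \<phi> (seg I l m) V) (wtype \<phi> (seg I m n) V)"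
  using wtype_Un[OF before_seg[where n = m and l = m, OF assms(1) order_refl]] seg_Un[OF assms(2,3)]
  by metis

text \<open>A pair of cut points is coloured with the type of the segment between them. On a
  homogeneous set, three consecutive cuts show a segment of type \<open>f\<close> composed of two of
  type \<open>f\<close>, hence idempotence.\<close>

lemma ramsey_segments:
  assumes "ordered d I"
  obtains n :: "nat \<Rightarrow> nat" and f where "strict_mono n" "0 < n 0"
    "\<And>i j. i < j \<Longrightarrow> wtype \<phi> (seg I (n i) (n j)) V = f" "mul \<phi> f f = f"
proof -
  define c where "c X = wtype \<phi> (seg I (Min X) (Max X)) V" for X :: "nat set"
  obtain s where s: "\<And>I V. wtype \<phi> I V < s"
    using finite_types[of \<phi>] unfolding finite_nat_set_iff_bounded by auto
  \<comment> \<open>Cutting inside \<open>{1..}\<close> keeps the prefix before the first cut from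
    being an empty product.\<close>
  have "\<exists>Y t. Y \<subseteq> {1..} \<and> infinite Y \<and> t < s \<and> (\<forall>x\<in>Y. \<forall>y\<in>Y. x \<noteq> y \<longrightarrow> c {x, y} = t)"
    by (rule Ramsey2) (simp_all add: c_def s infinite_Ici)
  then obtain Y f where Y: "Y \<subseteq> {1..}" "infinite Y"
    and "\<forall>x\<in>Y. \<forall>y\<in>Y. x \<noteq> y \<longrightarrow> c {x, y} = f" by (elim exE conjE)
  then have f: "\<And>x y. x \<in> Y \<Longrightarrow> y \<in> Y \<Longrightarrow> x \<noteq> y \<Longrightarrow> c {x, y} = f" by simp
  define n where "n = enumerate Y"
  have n: "strict_mono n" unfolding n_def by (rule strict_mono_enumerate[OF Y(2)])
  have nY: "n i \<in> Y" for i unfolding n_def by (rule enumerate_in_set[OF Y(2)])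
  have eq: "wtype \<phi> (seg I (n i) (n j)) V = f" if "i < j" for i j
  proof -
    have "n i < n j" using n that by (simp add: strict_mono_less)
    then show ?thesis using f[OF nY nY, of i j] by (simp add: c_def)
  qed
  have "n 0 \<le> n 1" "n 1 \<le> n 2" using n by (simp_all add: strict_mono_less_eq)
  then have "mul \<phi> f f = f"
    using wtype_seg_Un[where l = "n 0" and m = "n 1" and n = "n 2" and \<phi> = \<phi> and V = V, OF assms] eq by (simp add: mulD_def split: if_splits)
  moreover have "0 < n 0" using nY[of 0] Y(1) by auto
  ultimately show thesis using that n eq by blast
qed

text \<open>Once a set has been chosen, the segments no longer share a type, so the induction
  hypothesis applies only to blocks regrouped by Ramsey's theorem. Idempotence of \<open>e\<close>
  ensures that regrouping yields no new types.\<close>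

theorem wtype_UN:
  assumes "ordered d I" "\<And>i. wtype \<phi> (I i) V = e" "mul \<phi> e e = e"
  shows "wtype \<phi> (\<Union>i. I i) V = omega d \<phi> e"
  using assms
proof (induction \<phi> arbitrary: I V e)
  case (At k p q)
  let ?X = "V p" and ?Y = "V q"
  have e: "atom (I i) ?X ?Y = set_decode e" for i
    using At(2)[of i] by auto
  \<comment> \<open>Idempotence means that a pair \<open>x < y\<close> spread over two segments
    already has a counterpart inside a single one.\<close>
  have ee: "0 \<in> set_decode e \<Longrightarrow> 1 \<in> set_decode e \<Longrightarrow> 3 \<in> set_decode e"
  proof -
    assume "0 \<in> set_decode e" "1 \<in> set_decode e"
    then have "3 \<in> set_decode (mul (At k p q) e e)" by simp
    then show ?thesis by (simp only: At(3))
  qed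
  have e3: "3 \<in> set_decode e" if "x \<in> I i" "y \<in> I j" "x \<in> ?X" "y \<in> ?Y" "x < y" for x y i j
  proof (cases "i = j")
    case True
    then have "3 \<in> atom (I i) ?X ?Y" using that unfolding atom_def by auto
    then show ?thesis using e by simp
  next
    case False
    have "0 \<in> atom (I i) ?X ?Y" "1 \<in> atom (I j) ?X ?Y" using that unfolding atom_def by auto
    then show ?thesis using e ee by simp
  qed
  have "b \<in> atom (I 0) ?X ?Y" if b: "b \<in> atom (\<Union>i. I i) ?X ?Y" for b
  proof -
    have "(\<exists>i. b \<in> atom (I i) ?X ?Y) \<or> b \<in> set_decode e"
    proof (cases "b = 3")
      case True
      then obtain i j x y where "x \<in> I i" "y \<in> I j" "x \<in> ?X" "y \<in> ?Y" "x < y"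
        using b by (auto simp: atom_3)
      then show ?thesis using e3 True by blast
    next
      case False
      then show ?thesis using b unfolding atom_def by auto
    qed
    then show ?thesis by (simp only: e) blast
  qed
  then have "atom (\<Union>i. I i) ?X ?Y \<subseteq> atom (I 0) ?X ?Y" by (rule subsetI)
  moreover have "atom (I 0) ?X ?Y \<subseteq> atom (\<Union>i. I i) ?X ?Y" unfolding atom_def by auto
  ultimately have "atom (\<Union>i. I i) ?X ?Y = set_decode e" using e by blast
  then show ?case by simp
next
  case (NotF \<phi>)
  then show ?case by simp
next
  case (AndF \<phi> \<psi>)
  have *: "pair (wtype \<phi> (I i) V) (wtype \<psi> (I i) V) = e" for i using AndF.prems(2)[of i] by simp
  have "wtype \<phi> (I i) V = pfst e" "wtype \<psi> (I i) V = psnd e" for i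
    by (simp_all flip: *[of i])
  moreover have "mul \<phi> (pfst e) (pfst e) = pfst e" "mul \<psi> (psnd e) (psnd e) = psnd e"
    using AndF.prems(3) by (metis mul.simps(3) pfst_pair psnd_pair)+
  ultimately show ?case
    using AndF.IH(1)[of I V "pfst e"] AndF.IH(2)[of I V "psnd e"] AndF.prems(1) by simp
next
  case (ExF x \<phi>)
  note fun_upd_apply [simp del]
  define S where "S = set_decode e"
  have S: "S = range (\<lambda>B. wtype \<phi> (I i) (V(x := B)))" for i
    unfolding S_def ExF.prems(2)[of i, symmetric] by simp
  have tpS: "wtype \<phi> (I i) (V(x := B)) \<in> S" for i B
    unfolding S[of i] by (rule rangeI)
  \<comment> \<open>For a quantified formula, idempotence of \<open>e\<close> makes its set of types
    closed under products, so finite blocks have their types in \<open>S\<close>.\<close>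
  have SS: "{mul \<phi> a b |a b. a \<in> S \<and> b \<in> S} = S"
  proof -
    have "set_decode (mul (ExF x \<phi>) e e) = S" unfolding S_def ExF.prems(3) ..
    then show ?thesis by (simp add: S_def)
  qed
  then have closed: "mulD d \<phi> a b \<in> S" if "a \<in> S" "b \<in> S" for a b
    using that SS unfolding mulD_def by auto
  have segS: "wtype \<phi> (seg I l m) (V(x := B)) \<in> S" if "l < m" for l m B
    using that
  proof (induction m)
    case (Suc m)
    show ?case
    proof (cases "l = m")
      case True
      then have "seg I l (Suc m) = I l" unfolding seg_def by auto
      then show ?thesis by (simp only: tpS)
    next
      case False
      then have "wtype \<phi> (seg I l m) (V(x := B)) \<in> S" using Suc by simp
      moreover have "seg I m (Suc m) = I m" unfolding seg_def by auto
      moreover have "wtype \<phi> (I m) (V(x := B)) \<in> S" by (rule tpS)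
      ultimately show ?thesis
        using wtype_seg_Un[where l = l and m = m and n = "Suc m" and \<phi> = \<phi> and V = "V(x := B)", OF ExF.prems(1)] closed Suc.prems by simp
    qed
  qed simp
  have dec: "\<exists>s f. wtype \<phi> (\<Union>i. I i) (V(x := B)) = mulD d \<phi> s (omega d \<phi> f) \<and> s \<in> S \<and> f \<in> S \<and> mul \<phi> f f = f" for B
  proof -
    let ?W = "V(x := B)"
    obtain n :: "nat \<Rightarrow> nat" and f where n: "strict_mono n" "0 < n 0"
      and f: "\<And>i j. i < j \<Longrightarrow> wtype \<phi> (seg I (n i) (n j)) ?W = f" "mul \<phi> f f = f"
      using ramsey_segments[OF ExF.prems(1), of \<phi> ?W] by metis
    let ?J = "\<lambda>j. seg I (n j) (n (Suc j))"
    have nS: "n (Suc i) \<le> n j" if "i < j" for i j using n(1) that by (simp add: strict_mono_less_eq)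
    then have J: "ordered d ?J"
      unfolding ordered_def by (intro allI impI before_seg ExF.prems(1))
    have "wtype \<phi> (\<Union>j. ?J j) ?W = omega d \<phi> f"
      by (rule ExF.IH) (use J f in auto)
    moreover have "before d (seg I 0 (n 0)) (\<Union>j. ?J j)"
    proof -
      have "before d (seg I 0 (n 0)) (?J j)" for j
        using n(1) by (intro before_seg ExF.prems(1)) (simp_all add: strict_mono_less_eq)
      then show ?thesis unfolding before_def by blast
    qed
    ultimately have "wtype \<phi> (\<Union>i. I i) ?W = mulD d \<phi> (wtype \<phi> (seg I 0 (n 0)) ?W) (omega d \<phi> f)"
      by (simp only: UN_seg[OF n(1), of I] wtype_Un)
    moreover have "f \<in> S"
    proof -
      have "n 0 < n 1" using n(1) by (simp add: strict_mono_less)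
      then show ?thesis using segS[of "n 0" "n 1" B] f(1)[of 0 1] by simp
    qed
    ultimately show ?thesis using segS[OF n(2)] f(2) by (intro exI conjI)
  qed
  have comp: "\<exists>B. mulD d \<phi> s (omega d \<phi> f) = wtype \<phi> (\<Union>i. I i) (V(x := B))"
    if sf: "s \<in> S" "f \<in> S" "mul \<phi> f f = f" for s f
  proof -
    \<comment> \<open>Conversely, \<open>s\<close> is realised on the first segment and
      \<open>f\<close> on all others, each by a set of its own; these sets are then glued into
      \<open>C\<close>.\<close>
    have "\<forall>i. \<exists>B. wtype \<phi> (I i) (V(x := B)) = (if i = 0 then s else f)"
    proof
      fix i :: nat
      have "(if i = 0 then s else f) \<in> S" using sf(1,2) by simp
      then show "\<exists>B. wtype \<phi> (I i) (V(x := B)) = (if i = 0 then s else f)"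
        unfolding S[of i] by (metis imageE)
    qed
    from choice[OF this] obtain B
      where B: "\<forall>i. wtype \<phi> (I i) (V(x := B i)) = (if i = 0 then s else f)" ..
    define C where "C = (\<Union>i. B i \<inter> I i)"
    have disj: "I i \<inter> I j = {}" if "i \<noteq> j" for i j
    proof -
      have "before d (I i) (I j) \<or> before d (I j) (I i)"
        using orderedD[OF ExF.prems(1), of i j] orderedD[OF ExF.prems(1), of j i] that by linarith
      then show ?thesis unfolding before_def by (cases d) auto
    qed
    have "C \<inter> I i = B i \<inter> I i" for i
    proof (intro equalityI subsetI)
      fix u assume u: "u \<in> C \<inter> I i"
      then obtain j where "u \<in> B j" "u \<in> I j" unfolding C_def by blast
      moreover have "i = j" using disj[of i j] u calculation by blast
      ultimately show "u \<in> B i \<inter> I i" by simp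
    qed (auto simp: C_def)
    then have "wtype \<phi> (I i) (V(x := C)) = wtype \<phi> (I i) (V(x := B i))" for i
      by (intro wtype_cong) (simp add: fun_upd_apply)
    with B have C: "wtype \<phi> (I i) (V(x := C)) = (if i = 0 then s else f)" for i by simp
    have "wtype \<phi> (\<Union>i. I (Suc i)) (V(x := C)) = omega d \<phi> f"
      by (rule ExF.IH) (use C sf(3) ExF.prems(1) in \<open>auto simp: ordered_def\<close>)
    moreover have "before d (I 0) (\<Union>i. I (Suc i))"
      using orderedD[OF ExF.prems(1), of 0] unfolding before_def by blast
    moreover have "(\<Union>i. I i) = I 0 \<union> (\<Union>i. I (Suc i))"
    proof (intro equalityI subsetI)
      fix u assume "u \<in> (\<Union>i. I i)"
      then obtain i where "u \<in> I i" by blast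
      then show "u \<in> I 0 \<union> (\<Union>i. I (Suc i))" by (cases i) auto
    qed blast
    ultimately have "wtype \<phi> (\<Union>i. I i) (V(x := C)) = mulD d \<phi> s (omega d \<phi> f)"
      using C[of 0] by (simp only: wtype_Un simp_thms if_True)
    then show ?thesis by metis
  qed
  have "range (\<lambda>B. wtype \<phi> (\<Union>i. I i) (V(x := B))) =
      {mulD d \<phi> s (omega d \<phi> f) |s f. s \<in> S \<and> f \<in> S \<and> mul \<phi> f f = f}"
    (is "?L = ?R")
  proof (intro equalityI subsetI)
    fix u assume "u \<in> ?L"
    then show "u \<in> ?R" using dec by blast
  next
    fix u assume "u \<in> ?R"
    then show "u \<in> ?L" using comp by blast
  qed
  then show ?case unfolding S_def by simp
qed

section \<open>Rich words\<close>

text \<open>The type of a one-point segment; \<open>U\<close> is the set of the variables whose value contains the point.\<close>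

primrec ptype :: "fm \<Rightarrow> nat set \<Rightarrow> nat" where
  "ptype (At k i j) U = set_encode ((if i \<in> U then {0} else {}) \<union> (if j \<in> U then {1} else {}) \<union>
    (if i \<in> U \<and> j \<in> U then {2} else {}))"
| "ptype (NotF \<phi>) U = ptype \<phi> U"
| "ptype (AndF \<phi> \<psi>) U = pair (ptype \<phi> U) (ptype \<psi> U)"
| "ptype (ExF i \<phi>) U = set_encode {ptype \<phi> (U - {i}), ptype \<phi> (insert i U)}"

lemma wtype_singleton: "wtype \<phi> {a} V = ptype \<phi> {i. a \<in> V i}"
proof (induction \<phi> arbitrary: V)
  case (At k i j)
  have "atom {a} (V i) (V j) = (if a \<in> V i then {0} else {}) \<union> (if a \<in> V j then {1} else {}) \<union>
      (if a \<in> V i \<and> a \<in> V j then {2} else {})"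
    unfolding atom_def by auto
  then show ?case by simp
next
  case (ExF i \<phi>)
  let ?U = "{k. a \<in> V k}"
  have eq: "wtype \<phi> {a} (V(i := B)) = (if a \<in> B then ptype \<phi> (insert i ?U) else ptype \<phi> (?U - {i}))" for B
  proof -
    have "{k. a \<in> (V(i := B)) k} = (if a \<in> B then insert i ?U else ?U - {i})" by auto
    then show ?thesis unfolding ExF by (cases "a \<in> B") (simp_all only: if_True if_False)
  qed
  have "range (\<lambda>B. wtype \<phi> {a} (V(i := B))) = {ptype \<phi> (?U - {i}), ptype \<phi> (insert i ?U)}"
    unfolding eq
  proof (intro equalityI subsetI)
    fix u assume "u \<in> {ptype \<phi> (?U - {i}), ptype \<phi> (insert i ?U)}"
    then have "u = (if a \<in> {} then ptype \<phi> (insert i ?U) else ptype \<phi> (?U - {i})) \<or>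
        u = (if a \<in> {a} then ptype \<phi> (insert i ?U) else ptype \<phi> (?U - {i}))" by simp
    then show "u \<in> range (\<lambda>B. if a \<in> B then ptype \<phi> (insert i ?U) else ptype \<phi> (?U - {i}))"
      by (elim disjE) (rule range_eqI, assumption)+
  qed auto
  then show ?case by simp
qed auto

section \<open>The semigroup of types of finite words\<close>

definition word_val :: "int set \<Rightarrow> nat \<Rightarrow> int set" where
  "word_val P i = (if i = 0 then P else {})"

definition letter :: "fm \<Rightarrow> bool \<Rightarrow> nat" where
  "letter \<phi> b = ptype \<phi> (if b then {0} else {})"

lemma wtype_letter: "wtype \<phi> {a} (word_val P) = letter \<phi> (a \<in> P)"
proof -
  have "{i. a \<in> word_val P i} = (if a \<in> P then {0} else {})" unfolding word_val_def by auto
  then show ?thesis by (simp add: wtype_singleton letter_def)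
qed

text \<open>Right multiplication by letters mirrors writing a word letter by letter, and closure
  under two fixed operations can be tested on a finite set.\<close>

inductive_set wtypes :: "fm \<Rightarrow> nat set" for \<phi> where
  letter: "letter \<phi> b \<in> wtypes \<phi>"
| snoc: "s \<in> wtypes \<phi> \<Longrightarrow> mul \<phi> s (letter \<phi> b) \<in> wtypes \<phi>"

lemma wtypes_mul:
  assumes "s \<in> wtypes \<phi>" "t \<in> wtypes \<phi>" shows "mul \<phi> s t \<in> wtypes \<phi>"
  using assms(2)
  by (induction t rule: wtypes.induct) (simp_all add: assms(1) wtypes.snoc mul_assoc[symmetric])

lemma wtype_split:
  fixes a b c :: int
  assumes "a \<le> b" "b \<le> c"
  shows "wtype \<phi> {a..<c} V = mul \<phi> (wtype \<phi> {a..<b} V) (wtype \<phi> {b..<c} V)"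
proof -
  have "{a..<c} = {a..<b} \<union> {b..<c}" using assms by auto
  moreover have "before True {a..<b} {b..<c}" unfolding before_def by auto
  ultimately show ?thesis by (simp only: wtype_Un_forward)
qed

lemma ivl_singleton: "{a..<a + 1} = {a}" for a :: int by auto

lemma wtype_snoc:
  fixes a b :: int
  assumes "a \<le> b"
  shows "wtype \<phi> {a..<b + 1} (word_val P) = mul \<phi> (wtype \<phi> {a..<b} (word_val P)) (letter \<phi> (b \<in> P))"
  using wtype_split[of a b "b + 1"] assms by (simp add: ivl_singleton wtype_letter)

lemma wtype_interval_gen:
  assumes "a < b" shows "wtype \<phi> {a..<b} (word_val P) \<in> wtypes \<phi>"
proof -
  have "wtype \<phi> {a..<a + 1 + int n} (word_val P) \<in> wtypes \<phi>" for n
  proof (induction n)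
    case 0
    then show ?case by (simp add: ivl_singleton wtype_letter wtypes.letter)
  next
    case (Suc n)
    have "wtype \<phi> {a..<a + 1 + int n + 1} (word_val P) \<in> wtypes \<phi>"
      by (subst wtype_snoc) (simp, rule wtypes.snoc[OF Suc])
    then show ?case by (simp add: algebra_simps)
  qed
  from this[of "nat (b - a - 1)"] assms show ?thesis by simp
qed

definition occurs :: "bool list \<Rightarrow> int set \<Rightarrow> int \<Rightarrow> bool" where
  "occurs w P a \<longleftrightarrow> (\<forall>j<length w. a + int j \<in> P \<longleftrightarrow> w ! j)"

text \<open>The word is fixed before \<open>P\<close> and \<open>a\<close>, so its type is the same
  wherever it occurs; this takes the place of shift invariance.\<close>

lemma wtypes_word:
  assumes "s \<in> wtypes \<phi>"
  shows "\<exists>w. w \<noteq> [] \<and> (\<forall>P a. occurs w P a \<longrightarrow> wtype \<phi> {a..<a + int (length w)} (word_val P) = s)"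
  using assms
proof (induction s rule: wtypes.induct)
  case (letter b)
  have "wtype \<phi> {a..<a + int (length [b])} (word_val P) = letter \<phi> b" if "occurs [b] P a" for P a
    using that by (simp add: occurs_def ivl_singleton wtype_letter)
  then show ?case by (intro exI[of _ "[b]"]) simp
next
  case (snoc s b)
  then obtain w where w: "w \<noteq> []"
    "\<And>P a. occurs w P a \<Longrightarrow> wtype \<phi> {a..<a + int (length w)} (word_val P) = s" by blast
  have "wtype \<phi> {a..<a + int (length (w @ [b]))} (word_val P) = mul \<phi> s (letter \<phi> b)"
    if occ: "occurs (w @ [b]) P a" for P a
  proof -
    have "occurs w P a" "a + int (length w) \<in> P \<longleftrightarrow> b"
      using occ unfolding occurs_def by (auto simp: nth_append all_conj_distrib less_Suc_eq split: if_splits)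
    then have "wtype \<phi> {a..<a + int (length w) + 1} (word_val P) = mul \<phi> s (letter \<phi> b)"
      by (subst wtype_snoc) (simp_all add: w(2))
    then show ?thesis by (simp add: algebra_simps)
  qed
  then show ?case by (intro exI[of _ "w @ [b]"]) simp
qed

text \<open>\<open>omega\<close> is defined by recursion on formulas and is hard to handle
  algebraically. Realising a sequence of types by an actual word lets identities be proved by
  cutting one word in two ways.\<close>

lemma realize:
  assumes "\<And>i. t i \<in> wtypes \<phi>"
  obtains I P where "ordered d I" "\<And>i. wtype \<phi> (I i) (word_val P) = t i"
proof -
  have "\<forall>i. \<exists>w. w \<noteq> [] \<and> (\<forall>P a. occurs w P a \<longrightarrow> wtype \<phi> {a..<a + int (length w)} (word_val P) = t i)"
    using wtypes_word[OF assms] by blast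
  from choice[OF this] obtain w where w: "\<And>i P a. occurs (w i) P a \<Longrightarrow>
      wtype \<phi> {a..<a + int (length (w i))} (word_val P) = t i" by blast
  define c where "c i = (\<Sum>k<i. int (length (w k)))" for i
  \<comment> \<open>Blocks are laid outwards from 0. To the left, block \<open>i\<close> fills the
    positions from \<open>- c (Suc i)\<close> up to, but excluding, \<open>- c i\<close>.\<close>
  define st where "st i = (if d then c i else - c (Suc i))" for i
  define I where "I i = {st i..<st i + int (length (w i))}" for i
  define P where "P = {st i + int j |i j. j < length (w i) \<and> w i ! j}"
  have cSuc: "c (Suc i) = c i + int (length (w i))" for i unfolding c_def by simp
  have cmono: "i \<le> j \<Longrightarrow> c i \<le> c j" for i j
    by (induction j rule: dec_induct) (auto simp: cSuc)
  have ord: "ordered d I"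
    unfolding ordered_def before_def
  proof (intro allI impI ballI)
    fix i j x y assume "i < j" "x \<in> I i" "y \<in> I j"
    moreover have "c (Suc i) \<le> c j" using \<open>i < j\<close> by (intro cmono) simp
    ultimately show "if d then x < y else y < x"
      unfolding I_def st_def using cSuc[of i] cSuc[of j] by (cases d) auto
  qed
  have disj: "I i \<inter> I j = {}" if "i \<noteq> j" for i j
  proof -
    have "before d (I i) (I j) \<or> before d (I j) (I i)"
      using orderedD[OF ord, of i j] orderedD[OF ord, of j i] that by linarith
    then show ?thesis unfolding before_def by (cases d) auto
  qed
  have "occurs (w i) P (st i)" for i
    unfolding occurs_def
  proof (intro allI impI iffI)
    fix j assume j: "j < length (w i)"
    show "st i + int j \<in> P" if "w i ! j" using that j unfolding P_def by blast
    assume "st i + int j \<in> P"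
    then obtain i' j' where *: "j' < length (w i')" "w i' ! j'" "st i + int j = st i' + int j'"
      unfolding P_def by blast
    have "st i + int j \<in> I i" "st i' + int j' \<in> I i'" using j * unfolding I_def by auto
    then have "i = i'" using disj[of i i'] *(3) by auto
    then show "w i ! j" using * by simp
  qed
  then have "wtype \<phi> (I i) (word_val P) = t i" for i unfolding I_def by (rule w)
  with ord show thesis by (rule that)
qed

lemma finite_wtypes: "finite (wtypes \<phi>)"
proof (rule finite_subset[OF _ finite_types[of \<phi>]], rule subsetI)
  fix s assume s: "s \<in> wtypes \<phi>"
  obtain I P where "wtype \<phi> (I (0::nat)) (word_val P) = s"
    using realize[of "\<lambda>_. s" \<phi> True] s by metis
  then show "s \<in> range (\<lambda>(I, V). wtype \<phi> I V)" by (metis case_prod_conv rangeI)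
qed

lemma mulD_assoc: "mulD d \<phi> (mulD d \<phi> s t) u = mulD d \<phi> s (mulD d \<phi> t u)"
  unfolding mulD_def by (simp add: mul_assoc)

lemma wtypes_mulD: "s \<in> wtypes \<phi> \<Longrightarrow> t \<in> wtypes \<phi> \<Longrightarrow> mulD d \<phi> s t \<in> wtypes \<phi>"
  unfolding mulD_def by (simp add: wtypes_mul)

text \<open>\<open>(ab)\<^sup>\<omega> = a (ba)\<^sup>\<omega>\<close>, read off from a word of the form \<open>ababab...\<close>\<close>

lemma omega_conj:
  assumes "a \<in> wtypes \<phi>" "b \<in> wtypes \<phi>" and e: "mulD d \<phi> a b = e" "mul \<phi> e e = e"
    and f: "mulD d \<phi> b a = f" "mul \<phi> f f = f"
  shows "omega d \<phi> e = mulD d \<phi> a (omega d \<phi> f)"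
proof -
  have "(if even i then a else b) \<in> wtypes \<phi>" for i :: nat using assms(1,2) by simp
  then obtain I P where ord: "ordered d I"
    and tpI: "\<And>i. wtype \<phi> (I i) (word_val P) = (if even i then a else b)"
    using realize[of "\<lambda>i. if even i then a else b" \<phi> d] by metis
  let ?V = "word_val P"
  have b4: "before d (I i \<union> I (Suc i)) (I j \<union> I (Suc j))" if "Suc i < j" for i j
    using orderedD[OF ord, of i j] orderedD[OF ord, of "Suc i" j] orderedD[OF ord, of i "Suc j"]
      orderedD[OF ord, of "Suc i" "Suc j"] that
    unfolding before_def by auto
  have "wtype \<phi> (\<Union>i. I (2 * i) \<union> I (Suc (2 * i))) ?V = omega d \<phi> e"
  proof (rule wtype_UN)
    show "ordered d (\<lambda>i. I (2 * i) \<union> I (Suc (2 * i)))"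
      unfolding ordered_def using b4 by simp
    show "wtype \<phi> (I (2 * i) \<union> I (Suc (2 * i))) ?V = e" for i
      using wtype_Un[OF orderedD[OF ord], of "2 * i" "Suc (2 * i)"] e(1) by (simp add: tpI)
  qed fact
  moreover have "wtype \<phi> (\<Union>i. I (Suc (2 * i)) \<union> I (Suc (Suc (2 * i)))) ?V = omega d \<phi> f"
  proof (rule wtype_UN)
    show "ordered d (\<lambda>i. I (Suc (2 * i)) \<union> I (Suc (Suc (2 * i))))"
      unfolding ordered_def using b4 by simp
    show "wtype \<phi> (I (Suc (2 * i)) \<union> I (Suc (Suc (2 * i)))) ?V = f" for i
      using wtype_Un[OF orderedD[OF ord], of "Suc (2 * i)" "Suc (Suc (2 * i))"] f(1) by (simp add: tpI)
  qed fact
  moreover have "(\<Union>i. I (2 * i) \<union> I (Suc (2 * i))) =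
      I 0 \<union> (\<Union>i. I (Suc (2 * i)) \<union> I (Suc (Suc (2 * i))))" (is "?L = ?R")
  proof (intro equalityI subsetI)
    fix u assume "u \<in> ?L"
    then obtain i where i: "u \<in> I (2 * i) \<union> I (Suc (2 * i))" by blast
    show "u \<in> ?R"
    proof (cases i)
      case 0
      then have "u \<in> I 0 \<or> u \<in> I (Suc (2 * 0))" using i by simp
      then show ?thesis by blast
    next
      case (Suc j)
      then have "u \<in> I (Suc (Suc (2 * j))) \<or> u \<in> I (Suc (2 * i))" using i by simp
      then show ?thesis by blast
    qed
  next
    fix u assume "u \<in> ?R"
    then consider "u \<in> I (2 * 0)" | i where "u \<in> I (Suc (2 * i))" | i where "u \<in> I (2 * Suc i)" by auto
    then show "u \<in> ?L" by cases blast+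
  qed
  moreover have "before d (I 0) (\<Union>i. I (Suc (2 * i)) \<union> I (Suc (Suc (2 * i))))"
  proof -
    have "before d (I 0) (I (Suc k))" for k using orderedD[OF ord] by simp
    then show ?thesis unfolding before_def by blast
  qed
  ultimately show ?thesis using tpI[of 0] by (simp add: wtype_Un)
qed

text \<open>The idempotents that generate a minimal right ideal of the semigroup of word types.\<close>

definition right_minimal :: "fm \<Rightarrow> nat \<Rightarrow> bool" where
  "right_minimal \<phi> e \<longleftrightarrow> e \<in> wtypes \<phi> \<and> mul \<phi> e e = e \<and> (\<forall>t\<in>wtypes \<phi>. \<exists>y\<in>wtypes \<phi>. mul \<phi> (mul \<phi> e t) y = e)"

text \<open>An idempotent of a right ideal \<open>r S\<close> of least cardinality, found as an element of a
  least subsemigroup of it.\<close>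

lemma right_minimal_exists: "\<exists>e. right_minimal \<phi> e"
proof -
  let ?S = "wtypes \<phi>" and ?m = "mul \<phi>"
  have "letter \<phi> True \<in> ?S" by (rule wtypes.letter)
  then obtain r where r: "r \<in> ?S" "\<And>x. x \<in> ?S \<Longrightarrow> card (?m r ` ?S) \<le> card (?m x ` ?S)"
    using ex_has_least_nat[of "\<lambda>x. x \<in> ?S" _ "\<lambda>x. card (?m x ` ?S)"] by metis
  let ?R = "?m r ` ?S"
  have finR: "finite ?R" using finite_wtypes by simp
  have RS: "?R \<subseteq> ?S" using wtypes_mul r(1) by auto
  have ideal: "?m x y \<in> ?R" if "x \<in> ?R" "y \<in> ?S" for x y
    using that by (auto simp: mul_assoc wtypes_mul)
  have min: "?m x ` ?S = ?R" if "x \<in> ?R" for x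
    using ideal[OF that] RS that finR r(2) by (intro card_seteq) auto
  define sub where "sub T \<longleftrightarrow> T \<noteq> {} \<and> T \<subseteq> ?R \<and> (\<forall>x\<in>T. \<forall>y\<in>T. ?m x y \<in> T)" for T
  have "sub ?R" unfolding sub_def using r(1) RS ideal by blast
  then obtain T where T: "sub T" "\<And>T'. sub T' \<Longrightarrow> card T \<le> card T'"
    using ex_has_least_nat[of sub _ card] by metis
  have finT: "finite T" using T(1) finR unfolding sub_def by (auto intro: finite_subset)
  have least: "T' = T" if "T' \<subseteq> T" "T' \<noteq> {}" "\<And>x y. x \<in> T' \<Longrightarrow> y \<in> T' \<Longrightarrow> ?m x y \<in> T'" for T'
    by (rule card_seteq[OF finT that(1)], rule T(2)) (use that T(1) in \<open>auto simp: sub_def\<close>)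
  obtain e where e: "e \<in> T" using T(1) unfolding sub_def by blast
  have closed: "?m x y \<in> T" if "x \<in> T" "y \<in> T" for x y using T(1) that unfolding sub_def by blast
  \<comment> \<open>The two subsets of \<open>T\<close> considered now are subsemigroups, so by
    leastness each is all of \<open>T\<close>: the first supplies some \<open>y\<close> with
    \<open>e y = e\<close>, the second puts \<open>e\<close> itself among these
    \<open>y\<close>.\<close>
  have "?m e ` T = T"
  proof (rule least)
    show "?m e ` T \<subseteq> T" "?m e ` T \<noteq> {}" using closed e by auto
    fix x y assume "x \<in> ?m e ` T" "y \<in> ?m e ` T"
    then obtain x' y' where "x' \<in> T" "y' \<in> T" "x = ?m e x'" "y = ?m e y'" by blast
    then show "?m x y \<in> ?m e ` T"
      using closed e by (auto simp: mul_assoc intro!: imageI)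
  qed
  then obtain y where y: "y \<in> T" "?m e y = e" using e by (metis imageE)
  have "{y \<in> T. ?m e y = e} = T"
  proof (rule least)
    fix x y assume "x \<in> {y \<in> T. ?m e y = e}" "y \<in> {y \<in> T. ?m e y = e}"
    then show "?m x y \<in> {y \<in> T. ?m e y = e}" using closed by (auto simp: mul_assoc[symmetric])
  qed (use y in auto)
  then have ee: "?m e e = e" using e by blast
  have eR: "e \<in> ?R" using e T(1) unfolding sub_def by blast
  have "\<exists>y\<in>?S. ?m (?m e t) y = e" if "t \<in> ?S" for t
  proof -
    have "e \<in> ?m (?m e t) ` ?S" using min[OF ideal[OF eR that]] eR by simp
    then show ?thesis by (metis imageE)
  qed
  then show ?thesis unfolding right_minimal_def using ee eR RS by blast
qed

text \<open>In semigroup terms, \<open>e\<close> is a primitive idempotent. Right minimality gives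
  \<open>h y = e\<close> for some \<open>y\<close>, so that
  \<open>h e = h h y = h y = e\<close>.\<close>

lemma right_minimal_unit:
  assumes "right_minimal \<phi> e" "h \<in> wtypes \<phi>" "mul \<phi> h h = h" "mul \<phi> e h = h" "mul \<phi> h e = h"
  shows "h = e"
proof -
  obtain y where "mul \<phi> (mul \<phi> e h) y = e" using assms(1,2) unfolding right_minimal_def by blast
  then have "mul \<phi> h y = e" by (simp only: assms(4))
  then have "mul \<phi> h e = e" by (metis mul_assoc assms(3))
  then show ?thesis using assms(5) by simp
qed

text \<open>The conditions on \<open>h\<close> are left-right symmetric, so the one-sided notion
  \<open>right_minimal\<close> serves the leftward half of a word as well.\<close>

lemma right_minimal_unitD:
  assumes "right_minimal \<phi> e" "h \<in> wtypes \<phi>" "mulD d \<phi> h h = h" "mulD d \<phi> e h = h" "mulD d \<phi> h e = h"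
  shows "h = e"
  using right_minimal_unit[OF assms(1,2)] assms(3-) unfolding mulD_def by (simp split: if_splits)

section \<open>The type of a rich word\<close>

definition rich :: "int set \<Rightarrow> bool" where
  "rich P \<longleftrightarrow> (\<forall>w n. (\<exists>a\<ge>n. occurs w P a) \<and> (\<exists>a\<le>n. occurs w P a))"

definition half :: "bool \<Rightarrow> int set" where
  "half d = (if d then {0..} else {..<0})"

definition point :: "bool \<Rightarrow> nat \<Rightarrow> int set" where
  "point d k = {if d then int k else - 1 - int k}"

lemma ordered_point: "ordered d (point d)"
  unfolding ordered_def before_def point_def by auto

lemma UN_point: "(\<Union>k. point d k) = half d"
proof (intro equalityI subsetI)
  fix u assume "u \<in> half d"
  then have "u \<in> point d (if d then nat u else nat (- 1 - u))"
    unfolding half_def point_def by (auto split: if_splits)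
  then show "u \<in> (\<Union>k. point d k)" by blast
qed (auto simp: half_def point_def split: if_splits)

lemma seg_point: "seg (point d) m n = (if d then {int m..<int n} else {- int n..<- int m})"
proof (intro equalityI subsetI)
  fix u assume u: "u \<in> (if d then {int m..<int n} else {- int n..<- int m})"
  have "u \<in> point d (if d then nat u else nat (- 1 - u))"
    using u unfolding point_def by (auto split: if_splits)
  moreover have "(if d then nat u else nat (- 1 - u)) \<in> {m..<n}"
    using u by (auto split: if_splits)
  ultimately show "u \<in> seg (point d) m n" unfolding seg_def by blast
qed (auto simp: seg_def point_def split: if_splits)

text \<open>Since every finite word occurs in \<open>P\<close>, the idempotent \<open>f\<close> of a Ramsey factorization lies in the
  ideal generated by any given \<open>e\<close>.\<close>

lemma half_factorization:
  assumes P: "rich P" and e: "e \<in> wtypes \<phi>"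
  obtains g f x y where "g \<in> wtypes \<phi>" "f \<in> wtypes \<phi>" "x \<in> wtypes \<phi>" "y \<in> wtypes \<phi>"
    "wtype \<phi> (half d) (word_val P) = mulD d \<phi> g (omega d \<phi> f)"
    "mul \<phi> f f = f" "f = mulD d \<phi> (mulD d \<phi> x e) y"
proof -
  let ?V = "word_val P" and ?I = "point d"
  obtain n :: "nat \<Rightarrow> nat" and f where n: "strict_mono n" "0 < n 0"
    and f: "\<And>i j. i < j \<Longrightarrow> wtype \<phi> (seg ?I (n i) (n j)) ?V = f" "mul \<phi> f f = f"
    using ramsey_segments[OF ordered_point, of \<phi> d ?V] by metis
  have seg_gen: "wtype \<phi> (seg ?I k l) ?V \<in> wtypes \<phi>" if "k < l" for k l
    unfolding seg_point using that by (auto intro: wtype_interval_gen)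
  define J where "J j = seg ?I (n j) (n (Suc j))" for j
  have "wtype \<phi> (\<Union>j. J j) ?V = omega d \<phi> f"
  proof (rule wtype_UN)
    have "n (Suc i) \<le> n j" if "i < j" for i j using n(1) that by (simp add: strict_mono_less_eq)
    then show "ordered d J"
      unfolding ordered_def J_def by (intro allI impI before_seg ordered_point)
  qed (use f in \<open>simp_all add: J_def\<close>)
  moreover have "before d (seg ?I 0 (n 0)) (\<Union>j. J j)"
  proof -
    have "before d (seg ?I 0 (n 0)) (J j)" for j
      unfolding J_def using n(1) by (intro before_seg ordered_point) (simp_all add: strict_mono_less_eq)
    then show ?thesis unfolding before_def by blast
  qed
  moreover have "half d = seg ?I 0 (n 0) \<union> (\<Union>j. J j)"
    unfolding J_def UN_point[symmetric] by (rule UN_seg[OF n(1)])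
  ultimately have wtype: "wtype \<phi> (half d) ?V = mulD d \<phi> (wtype \<phi> (seg ?I 0 (n 0)) ?V) (omega d \<phi> f)"
    by (simp only: wtype_Un)
  obtain w where w: "w \<noteq> []"
    "\<And>P a. occurs w P a \<Longrightarrow> wtype \<phi> {a..<a + int (length w)} (word_val P) = e"
    using wtypes_word[OF e] by blast
  \<comment> \<open>The occurrence is taken beyond the first cut with a gap of at least one
    position; \<open>k\<close> is then so large that the cut \<open>n k\<close> lies beyond it too.
    Both flanking pieces are nonempty, as membership in \<open>wtypes\<close> requires.\<close>
  obtain a where a: "occurs w P a"
    "if d then int (n 0) + 1 \<le> a else a \<le> - int (n 0) - 1 - int (length w)"
    using P unfolding rich_def by (cases d) (simp_all, blast+)
  define k where "k = nat \<bar>a\<bar> + length w + 1"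
  have "k \<le> n k" using strict_mono_imp_increasing[OF n(1)] .
  define l r where "l = (if d then int (n 0) else - int (n k))"
    and "r = (if d then int (n k) else - int (n 0))"
  have lr: "l < a" "a + int (length w) < r"
    using a(2) \<open>k \<le> n k\<close> unfolding l_def r_def k_def by (auto split: if_splits)
  have "seg ?I (n 0) (n k) = {l..<r}" unfolding seg_point l_def r_def by simp
  then have "f = wtype \<phi> {l..<r} ?V" using f(1)[of 0 k] by (simp add: k_def)
  also have "\<dots> = mul \<phi> (wtype \<phi> {l..<a} ?V) (wtype \<phi> {a..<r} ?V)"
    by (rule wtype_split) (use lr in auto)
  also have "wtype \<phi> {a..<r} ?V = mul \<phi> e (wtype \<phi> {a + int (length w)..<r} ?V)"
    by (subst wtype_split[of _ "a + int (length w)"]) (use lr w(2)[OF a(1)] in auto)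
  finally have fe: "f = mul \<phi> (mul \<phi> (wtype \<phi> {l..<a} ?V) e) (wtype \<phi> {a + int (length w)..<r} ?V)"
    by (simp only: mul_assoc)
  have xy: "wtype \<phi> {l..<a} ?V \<in> wtypes \<phi>" "wtype \<phi> {a + int (length w)..<r} ?V \<in> wtypes \<phi>"
    using lr by (auto intro: wtype_interval_gen)
  have fg: "f \<in> wtypes \<phi>" unfolding fe using xy e by (intro wtypes_mul)
  have "\<exists>x\<in>wtypes \<phi>. \<exists>y\<in>wtypes \<phi>. f = mulD d \<phi> (mulD d \<phi> x e) y"
  proof (cases d)
    case True
    then show ?thesis using fe xy unfolding mulD_def by auto
  next
    case False
    then have "f = mulD d \<phi> (mulD d \<phi> (wtype \<phi> {a + int (length w)..<r} ?V) e) (wtype \<phi> {l..<a} ?V)"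
      using fe by (simp add: mulD_def mul_assoc)
    then show ?thesis using xy by blast
  qed
  then show thesis using that[OF seg_gen[OF n(2)] fg _ _ wtype f(2)] by blast
qed

text \<open>The idempotent \<open>f = x e y\<close> is conjugate to \<open>e\<close>: for
  \<open>a = f x e\<close> and \<open>b = e y f\<close>, \<open>a b = f\<close>, while
  \<open>b a\<close> is an idempotent below \<open>e\<close> and so equals \<open>e\<close> by
  minimality. Rotation then gives f^omega = a e^omega, all products being taken in direction
  \<open>d\<close>.\<close>

lemma half_type:
  assumes P: "rich P" and e: "right_minimal \<phi> e"
  obtains p where "p \<in> wtypes \<phi>" "wtype \<phi> (half d) (word_val P) = mulD d \<phi> p (omega d \<phi> e)"
proof -
  have eg: "e \<in> wtypes \<phi>" and ee: "mul \<phi> e e = e" using e unfolding right_minimal_def by auto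
  obtain g f x y where g: "g \<in> wtypes \<phi>" "f \<in> wtypes \<phi>" "x \<in> wtypes \<phi>" "y \<in> wtypes \<phi>"
    and wtype: "wtype \<phi> (half d) (word_val P) = mulD d \<phi> g (omega d \<phi> f)"
    and ff: "mul \<phi> f f = f" and f: "f = mulD d \<phi> (mulD d \<phi> x e) y"
    using half_factorization[OF P eg, of d thesis] by blast
  define M where "M = mulD d \<phi>"
  have assoc: "M (M s t) u = M s (M t u)" for s t u unfolding M_def by (rule mulD_assoc)
  have MS: "M s t \<in> wtypes \<phi>" if "s \<in> wtypes \<phi>" "t \<in> wtypes \<phi>" for s t
    unfolding M_def using that by (rule wtypes_mulD)
  have MM: "M e e = e" "M f f = f" using ee ff unfolding M_def mulD_def by auto
  have ef: "M e (M e s) = M e s" "M f (M f s) = M f s" for s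
    using MM assoc by metis+
  have fx: "M x (M e y) = f" "M x (M e (M y s)) = M f s" for s
    using f assoc unfolding M_def[symmetric] by metis+
  define a b where "a = M f (M x e)" and "b = M e (M y f)"
  have ab: "a \<in> wtypes \<phi>" "b \<in> wtypes \<phi>" unfolding a_def b_def using g eg by (auto intro: MS)
  have "M a b = f" unfolding a_def b_def by (simp add: assoc MM ef fx)
  moreover have ba: "M b a = e"
  proof (rule right_minimal_unitD[OF e, of _ d, folded M_def])
    show "M b a \<in> wtypes \<phi>" using ab by (rule MS[rotated])
    show "M (M b a) (M b a) = M b a" "M e (M b a) = M b a" "M (M b a) e = M b a"
      unfolding a_def b_def by (simp_all add: assoc MM ef fx)
  qed
  ultimately have "omega d \<phi> f = M a (omega d \<phi> e)"
    unfolding M_def using omega_conj[OF ab _ ff _ ee] by blast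
  then have "wtype \<phi> (half d) (word_val P) = M (M g a) (omega d \<phi> e)"
    using wtype by (simp add: M_def mulD_assoc)
  then show thesis using that MS[OF g(1) ab(1)] unfolding M_def by blast
qed

theorem wtype_rich:
  assumes P: "rich P" and e: "right_minimal \<phi> e"
  shows "wtype \<phi> UNIV (word_val P) = mul \<phi> (omega False \<phi> e) (omega True \<phi> e)"
proof -
  let ?m = "mul \<phi>"
  have eg: "e \<in> wtypes \<phi>" and ee: "?m e e = e" using e unfolding right_minimal_def by auto
  obtain p where p: "p \<in> wtypes \<phi>" "wtype \<phi> (half False) (word_val P) = ?m (omega False \<phi> e) p"
    using half_type[OF P e, of False] unfolding mulD_def by auto
  obtain q where q: "q \<in> wtypes \<phi>" "wtype \<phi> (half True) (word_val P) = ?m q (omega True \<phi> e)"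
    using half_type[OF P e, of True] unfolding mulD_def by auto
  \<comment> \<open>Rotation with both factors equal to \<open>e\<close> splits off one copy of
    \<open>e\<close> on each side, so that the middle factor becomes \<open>e p q e\<close>.\<close>
  have omL: "omega False \<phi> e = ?m (omega False \<phi> e) e"
    using omega_conj[OF eg eg, of False e e] ee unfolding mulD_def by simp
  have omR: "omega True \<phi> e = ?m e (omega True \<phi> e)"
    using omega_conj[OF eg eg, of True e e] ee unfolding mulD_def by simp
  define m where "m = ?m e (?m (?m p q) e)"
  have pq: "?m p q \<in> wtypes \<phi>" "?m (?m p q) e \<in> wtypes \<phi>" using p(1) q(1) eg by (auto intro: wtypes_mul)
  then have mg: "m \<in> wtypes \<phi>" unfolding m_def by (intro wtypes_mul[OF eg])
  have em: "?m e m = m" "?m m e = m" unfolding m_def by (metis mul_assoc ee)+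
  obtain y where y: "y \<in> wtypes \<phi>" "?m m y = e"
    using e pq(2) unfolding right_minimal_def m_def by blast
  \<comment> \<open>\<open>e y e\<close> moves the right inverse into the group with unit
    \<open>e\<close>; that it is a left inverse too follows from minimality.\<close>
  define z where "z = ?m e (?m y e)"
  have zg: "z \<in> wtypes \<phi>" unfolding z_def using y(1) eg by (intro wtypes_mul)
  have ez: "?m e z = z" "?m z e = z" unfolding z_def by (metis mul_assoc ee)+
  have mz: "?m m z = e" unfolding z_def by (metis mul_assoc ee em(2) y(2))
  have zm: "?m z m = e"
  proof (rule right_minimal_unit[OF e])
    show "?m z m \<in> wtypes \<phi>" using zg mg by (rule wtypes_mul)
    show "?m (?m z m) (?m z m) = ?m z m" by (metis mul_assoc mz ez(2))
    show "?m e (?m z m) = ?m z m" by (metis mul_assoc ez(1))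
    show "?m (?m z m) e = ?m z m" by (metis mul_assoc em(2))
  qed
  have m: "omega True \<phi> e = ?m m (omega True \<phi> e)"
    using omega_conj[OF mg zg, of True e e] mz zm ee unfolding mulD_def by simp
  have UNIV: "half False \<union> half True = UNIV" unfolding half_def by auto
  have "before True (half False) (half True)" unfolding half_def before_def by auto
  from wtype_Un_forward[OF this, of \<phi> "word_val P"]
  have "wtype \<phi> UNIV (word_val P) = ?m (?m (omega False \<phi> e) p) (?m q (omega True \<phi> e))"
    by (simp only: UNIV p(2) q(2))
  also have "\<dots> = ?m (?m (?m (omega False \<phi> e) e) p) (?m q (?m e (omega True \<phi> e)))"
    using omL omR by simp
  also have "\<dots> = ?m (omega False \<phi> e) (?m m (omega True \<phi> e))"
    unfolding m_def by (simp only: mul_assoc)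
  also have "\<dots> = ?m (omega False \<phi> e) (omega True \<phi> e)"
    using m by simp
  finally show ?thesis .
qed

section \<open>Decidability\<close>

text \<open>Every \<open>k\<close> above 1 is read as the test selected by 2, so that each number
  decoded to an atom has a meaning.\<close>

primrec accepts :: "fm \<Rightarrow> nat \<Rightarrow> bool" where
  "accepts (At k i j) t \<longleftrightarrow> (if k = 0 then 2 \<in> set_decode t
    else if k = 1 then 2 \<in> set_decode t \<or> 3 \<in> set_decode t
    else 2 \<in> set_decode t \<and> 3 \<notin> set_decode t)"
| "accepts (NotF \<phi>) t \<longleftrightarrow> \<not> accepts \<phi> t"
| "accepts (AndF \<phi> \<psi>) t \<longleftrightarrow> accepts \<phi> (pfst t) \<and> accepts \<psi> (psnd t)"
| "accepts (ExF i \<phi>) t \<longleftrightarrow> (\<exists>s\<in>set_decode t. accepts \<phi> s)"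

text \<open>The set variable \<open>0\<close> stands for \<open>P\<close>, the odd ones for the first-order variables and the
  remaining ones for the set variables of \<open>mso\<close>.\<close>

primrec core :: "mso \<Rightarrow> fm" where
  "core (Eq x y) = At 0 (Suc (x + x)) (Suc (y + y))"
| "core (Le x y) = At 1 (Suc (x + x)) (Suc (y + y))"
| "core (InP x) = At 0 (Suc (x + x)) 0"
| "core (Mem x X) = At 0 (Suc (x + x)) (Suc (Suc (X + X)))"
| "core (Neg \<phi>) = NotF (core \<phi>)"
| "core (Conj \<phi> \<psi>) = AndF (core \<phi>) (core \<psi>)"
| "core (ExFO x \<phi>) = ExF (Suc (x + x)) (AndF (At 2 (Suc (x + x)) (Suc (x + x))) (core \<phi>))"
| "core (ExSO X \<phi>) = ExF (Suc (Suc (X + X))) (core \<phi>)"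

lemma accepts_ExF: "accepts (ExF i \<phi>) (wtype (ExF i \<phi>) I V) \<longleftrightarrow> (\<exists>B. accepts \<phi> (wtype \<phi> I (V(i := B))))"
  by (simp add: finite_wtype_ex del: fun_upd_apply)

lemma accepts_singleton: "accepts (At 2 i i) (wtype (At 2 i i) UNIV V) \<longleftrightarrow> (\<exists>a. V i = {a})"
proof -
  have "accepts (At 2 i i) (wtype (At 2 i i) UNIV V) \<longleftrightarrow>
      (\<exists>x. x \<in> V i) \<and> \<not> (\<exists>x y. x \<in> V i \<and> y \<in> V i \<and> x < y)"
    by (simp add: atom_2 atom_3)
  also have "\<dots> \<longleftrightarrow> (\<exists>a. V i = {a})"
  proof
    assume *: "(\<exists>x. x \<in> V i) \<and> \<not> (\<exists>x y. x \<in> V i \<and> y \<in> V i \<and> x < y)"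
    then obtain a where a: "a \<in> V i" by blast
    then have "x = a" if "x \<in> V i" for x using * that by (meson linorder_neqE)
    then show "\<exists>a. V i = {a}" using a by blast
  qed auto
  finally show ?thesis .
qed

text \<open>Only the free variables must correspond. For a sentence this leaves \<open>P\<close> at
  variable 0, and \<open>word_val\<close> may put the empty set everywhere else.\<close>

lemma accepts_core:
  assumes "\<And>x. x \<in> free_fo \<phi> \<Longrightarrow> U (Suc (x + x)) = {v x}"
    "\<And>X. X \<in> free_so \<phi> \<Longrightarrow> U (Suc (Suc (X + X))) = V X" "U 0 = P"
  shows "accepts (core \<phi>) (wtype (core \<phi>) UNIV U) \<longleftrightarrow> sat P v V \<phi>"
  using assms
proof (induction \<phi> arbitrary: U v V)
  case (Eq x y)
  have "U (Suc (x + x)) = {v x}" "U (Suc (y + y)) = {v y}" by (simp_all add: Eq.prems(1))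
  then show ?case by (simp add: atom_2)
next
  case (Le x y)
  have "U (Suc (x + x)) = {v x}" "U (Suc (y + y)) = {v y}" by (simp_all add: Le.prems(1))
  then show ?case by (simp add: atom_2 atom_3) auto
next
  case (InP x)
  have "U (Suc (x + x)) = {v x}" by (simp add: InP.prems(1))
  then show ?case by (simp add: atom_2 InP.prems(3))
next
  case (Mem x X)
  have "U (Suc (x + x)) = {v x}" "U (Suc (Suc (X + X))) = V X"
    by (simp_all add: Mem.prems(1,2))
  then show ?case by (simp add: atom_2)
next
  case (Neg \<phi>)
  have "accepts (core \<phi>) (wtype (core \<phi>) UNIV U) \<longleftrightarrow> sat P v V \<phi>"
    by (rule Neg.IH) (use Neg.prems in auto)
  then show ?case by simp
next
  case (Conj \<phi> \<psi>)
  have "accepts (core \<phi>) (wtype (core \<phi>) UNIV U) \<longleftrightarrow> sat P v V \<phi>"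
    "accepts (core \<psi>) (wtype (core \<psi>) UNIV U) \<longleftrightarrow> sat P v V \<psi>"
    by (rule Conj.IH; use Conj.prems in auto)+
  then show ?case by simp
next
  case (ExFO x \<phi>)
  let ?i = "Suc (x + x)"
  have IH: "accepts (core \<phi>) (wtype (core \<phi>) UNIV (U(?i := {a}))) \<longleftrightarrow> sat P (v(x := a)) V \<phi>" for a
  proof (rule ExFO.IH)
    show "(U(?i := {a})) (Suc (y + y)) = {(v(x := a)) y}" if "y \<in> free_fo \<phi>" for y
      using ExFO.prems(1)[of y] that by auto
    have "Suc (X + X) \<noteq> x + x" for X by presburger
    then show "(U(?i := {a})) (Suc (Suc (X + X))) = V X" if "X \<in> free_so \<phi>" for X
      using ExFO.prems(2)[of X] that by simp
  qed (simp add: ExFO.prems(3))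
  have "accepts (core (ExFO x \<phi>)) (wtype (core (ExFO x \<phi>)) UNIV U) \<longleftrightarrow>
      (\<exists>B. (\<exists>a. (U(?i := B)) ?i = {a}) \<and> accepts (core \<phi>) (wtype (core \<phi>) UNIV (U(?i := B))))"
    unfolding core.simps accepts_ExF accepts.simps(3) wtype.simps(3) pfst_pair psnd_pair accepts_singleton ..
  also have "\<dots> \<longleftrightarrow> (\<exists>a. sat P (v(x := a)) V \<phi>)"
    unfolding fun_upd_same using IH by blast
  finally show ?case by simp
next
  case (ExSO X \<phi>)
  let ?i = "Suc (Suc (X + X))"
  have IH: "accepts (core \<phi>) (wtype (core \<phi>) UNIV (U(?i := B))) \<longleftrightarrow> sat P v (V(X := B)) \<phi>" for B
  proof (rule ExSO.IH)
    have "x + x \<noteq> Suc (X + X)" for x by presburger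
    then show "(U(?i := B)) (Suc (x + x)) = {v x}" if "x \<in> free_fo \<phi>" for x
      using ExSO.prems(1)[of x] that by simp
    show "(U(?i := B)) (Suc (Suc (Y + Y))) = (V(X := B)) Y" if "Y \<in> free_so \<phi>" for Y
      using ExSO.prems(2)[of Y] that by auto
  qed (simp add: ExSO.prems(3))
  show ?case unfolding core.simps accepts_ExF IH by simp
qed

primrec free_vars :: "fm \<Rightarrow> nat set" where
  "free_vars (At k i j) = {i, j}"
| "free_vars (NotF \<phi>) = free_vars \<phi>"
| "free_vars (AndF \<phi> \<psi>) = free_vars \<phi> \<union> free_vars \<psi>"
| "free_vars (ExF i \<phi>) = free_vars \<phi> - {i}"

lemma finite_free [simp]: "finite (free_vars \<phi>)" by (induction \<phi>) auto

lemma odd_free_core: "Suc (x + x) \<in> free_vars (core \<phi>) \<longleftrightarrow> x \<in> free_fo \<phi>"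
  by (induction \<phi>) (auto; presburger)+

lemma even_free_core: "Suc (Suc (X + X)) \<in> free_vars (core \<phi>) \<longleftrightarrow> X \<in> free_so \<phi>"
  by (induction \<phi>) (auto; presburger)+

text \<open>Moves the test for being a sentence to the translation, so that free variables are
  computed for one kind of formula only.\<close>

lemma sentence_core: "sentence \<phi> \<longleftrightarrow> (\<forall>k\<in>free_vars (core \<phi>). k = 0)"
proof -
  have "k = 0 \<or> (\<exists>x. k = Suc (x + x)) \<or> (\<exists>x. k = Suc (Suc (x + x)))" for k :: nat by presburger
  then have "(\<forall>k\<in>free_vars (core \<phi>). k = 0) \<longleftrightarrow>
      (\<forall>x. Suc (x + x) \<notin> free_vars (core \<phi>)) \<and> (\<forall>x. Suc (Suc (x + x)) \<notin> free_vars (core \<phi>))"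
    by (metis nat.distinct(1))
  then show ?thesis unfolding odd_free_core even_free_core sentence_def by auto
qed

lemma MTh_iff:
  "\<phi> \<in> MTh \<xi> \<longleftrightarrow> sentence \<phi> \<and> accepts (core \<phi>) (wtype (core \<phi>) UNIV (word_val (\<xi> -` {True})))"
proof -
  have "sat (\<xi> -` {True}) v V \<phi> \<longleftrightarrow> accepts (core \<phi>) (wtype (core \<phi>) UNIV (word_val (\<xi> -` {True})))"
    if "sentence \<phi>" for v V
    by (rule accepts_core[symmetric]) (use that in \<open>auto simp: sentence_def word_val_def\<close>)
  then show ?thesis unfolding MTh_def by auto
qed

text \<open>By \<open>wtype_rich\<close> every right minimal \<open>e\<close> gives the same value;
  the least one is what minimisation finds.\<close>

definition rich_value :: "fm \<Rightarrow> nat" where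
  "rich_value \<phi> = (let e = LEAST e. right_minimal \<phi> e in mul \<phi> (omega False \<phi> e) (omega True \<phi> e))"

lemma wtype_rich_value: "rich P \<Longrightarrow> wtype \<phi> UNIV (word_val P) = rich_value \<phi>"
  unfolding rich_value_def Let_def by (rule wtype_rich) (use right_minimal_exists in \<open>auto intro: LeastI\<close>)

lemma MTh_rich:
  "rich (\<xi> -` {True}) \<Longrightarrow> MTh \<xi> = {\<phi>. sentence \<phi> \<and> accepts (core \<phi>) (rich_value (core \<phi>))}"
  using MTh_iff[of _ \<xi>] wtype_rich_value[of "\<xi> -` {True}"] by auto

section \<open>Codes of formulas and recursion over them\<close>

primrec fcode :: "fm \<Rightarrow> nat" where
  "fcode (At k i j) = pair 0 (pair k (pair i j))"
| "fcode (NotF \<phi>) = pair 1 (fcode \<phi>)"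
| "fcode (AndF \<phi> \<psi>) = pair 2 (pair (fcode \<phi>) (fcode \<psi>))"
| "fcode (ExF i \<phi>) = pair 3 (pair i (fcode \<phi>))"

lemma pfst_psnd_less: "0 < pfst c \<Longrightarrow> pfst (psnd c) < c" "0 < pfst c \<Longrightarrow> psnd (psnd c) < c"
  using psnd_less[of c] pfst_le[of "psnd c"] psnd_le[of "psnd c"] by auto

text \<open>Decoding is total: numbers that are not codes are decoded to some formula as well.\<close>

function fdec :: "nat \<Rightarrow> fm" where
  "fdec c = (if pfst c = 0 then At (pfst (psnd c)) (pfst (psnd (psnd c))) (psnd (psnd (psnd c)))
    else if pfst c = 1 then NotF (fdec (psnd c))
    else if pfst c = 2 then AndF (fdec (pfst (psnd c))) (fdec (psnd (psnd c)))
    else ExF (pfst (psnd c)) (fdec (psnd (psnd c))))"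
  by auto
termination by (relation "measure id") (auto intro: psnd_less pfst_psnd_less)

declare fdec.simps [simp del]

lemma fdec_fcode [simp]: "fdec (fcode \<phi>) = \<phi>"
  by (induction \<phi>) (subst fdec.simps; simp)+

function dec :: "nat \<Rightarrow> mso" where
  "dec c = (if pfst c = 0 then Eq (pfst (psnd c)) (psnd (psnd c))
    else if pfst c = 1 then Le (pfst (psnd c)) (psnd (psnd c))
    else if pfst c = 2 then InP (psnd c)
    else if pfst c = 3 then Mem (pfst (psnd c)) (psnd (psnd c))
    else if pfst c = 4 then Neg (dec (psnd c))
    else if pfst c = 5 then Conj (dec (pfst (psnd c))) (dec (psnd (psnd c)))
    else if pfst c = 6 then ExFO (pfst (psnd c)) (dec (psnd (psnd c)))
    else ExSO (pfst (psnd c)) (dec (psnd (psnd c))))"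
  by auto
termination by (relation "measure id") (auto intro: psnd_less pfst_psnd_less)

declare dec.simps [simp del]

lemma dec_code [simp]: "dec (code \<phi>) = \<phi>"
  by (induction \<phi>) (subst dec.simps; simp)+

text \<open>As decoding is total, \<open>code (dec c) = c\<close> is the test for being a code at
  all.\<close>

lemma Rec_code_dec: "Rec (\<lambda>c. code (dec c))"
proof (rule Rec_wf[where r = "\<lambda>x. x"])
  let ?\<Phi> = "\<lambda>c T. if pfst c = 0 then pair 0 (pair (pfst (psnd c)) (psnd (psnd c)))
    else if pfst c = 1 then pair 1 (pair (pfst (psnd c)) (psnd (psnd c)))
    else if pfst c = 2 then pair 2 (psnd c)
    else if pfst c = 3 then pair 3 (pair (pfst (psnd c)) (psnd (psnd c)))
    else if pfst c = 4 then pair 4 (lookup T (psnd c))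
    else if pfst c = 5 then pair 5 (pair (lookup T (pfst (psnd c))) (lookup T (psnd (psnd c))))
    else if pfst c = 6 then pair 6 (pair (pfst (psnd c)) (lookup T (psnd (psnd c))))
    else pair 7 (pair (pfst (psnd c)) (lookup T (psnd (psnd c))))"
  show "Rec (\<lambda>z. ?\<Phi> (pfst z) (psnd z))" by (intro rec_intros)
  show "code (dec c) = ?\<Phi> c T" if "\<And>y. y < c \<Longrightarrow> lookup T y = code (dec y)" for c T
    by (subst dec.simps) (simp add: that psnd_less pfst_psnd_less)
qed (intro rec_intros, simp)

lemma Rec_core: "Rec (\<lambda>c. fcode (core (dec c)))"
proof (rule Rec_wf[where r = "\<lambda>x. x"])
  let ?fo = "\<lambda>x. Suc (x + x)" and ?so = "\<lambda>x. Suc (Suc (x + x))"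
  let ?\<Phi> = "\<lambda>c T. if pfst c = 0 then pair 0 (pair 0 (pair (?fo (pfst (psnd c))) (?fo (psnd (psnd c)))))
    else if pfst c = 1 then pair 0 (pair 1 (pair (?fo (pfst (psnd c))) (?fo (psnd (psnd c)))))
    else if pfst c = 2 then pair 0 (pair 0 (pair (?fo (psnd c)) 0))
    else if pfst c = 3 then pair 0 (pair 0 (pair (?fo (pfst (psnd c))) (?so (psnd (psnd c)))))
    else if pfst c = 4 then pair 1 (lookup T (psnd c))
    else if pfst c = 5 then pair 2 (pair (lookup T (pfst (psnd c))) (lookup T (psnd (psnd c))))
    else if pfst c = 6 then pair 3 (pair (?fo (pfst (psnd c))) (pair 2 (pair
      (pair 0 (pair 2 (pair (?fo (pfst (psnd c))) (?fo (pfst (psnd c)))))) (lookup T (psnd (psnd c))))))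
    else pair 3 (pair (?so (pfst (psnd c))) (lookup T (psnd (psnd c))))"
  show "Rec (\<lambda>z. ?\<Phi> (pfst z) (psnd z))" by (intro rec_intros)
  show "fcode (core (dec c)) = ?\<Phi> c T" if "\<And>y. y < c \<Longrightarrow> lookup T y = fcode (core (dec y))" for c T
    by (subst dec.simps) (simp add: that psnd_less pfst_psnd_less)
qed (intro rec_intros, simp)

lemma Rec_free: "Rec (\<lambda>c. set_encode (free_vars (fdec c)))"
proof (rule Rec_wf[where r = "\<lambda>x. x"])
  let ?\<Phi> = "\<lambda>c T. if pfst c = 0 then set_encode (insert (pfst (psnd (psnd c))) (set_decode (2 ^ psnd (psnd (psnd c)))))
    else if pfst c = 1 then lookup T (psnd c)
    else if pfst c = 2 then set_encode (set_decode (lookup T (pfst (psnd c))) \<union> set_decode (lookup T (psnd (psnd c))))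
    else set_encode (set_decode (lookup T (psnd (psnd c))) - {pfst (psnd c)})"
  show "Rec (\<lambda>z. ?\<Phi> (pfst z) (psnd z))" by (intro rec_intros)
  have [simp]: "set_decode (2 ^ a) = {a}" for a
    using set_encode_inverse[of "{a}"] by (simp del: set_encode_inverse)
  show "set_encode (free_vars (fdec c)) = ?\<Phi> c T"
    if "\<And>y. y < c \<Longrightarrow> lookup T y = set_encode (free_vars (fdec y))" for c T
    by (subst fdec.simps) (simp add: that psnd_less pfst_psnd_less)
qed (intro rec_intros, simp)

lemma pair_less_left: "a < pfst x \<Longrightarrow> b \<le> psnd x \<Longrightarrow> pair a b < x"
  using pair_less[of a "pfst x" b "psnd x"] by simp

lemma pair_le: "a \<le> pfst x \<Longrightarrow> b \<le> psnd x \<Longrightarrow> pair a b \<le> x"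
  using pair_mono[of a "pfst x" b "psnd x"] by simp

lemma mul_At: "mul (At k i j) s t = (if 0 \<in> set_decode s \<and> 1 \<in> set_decode t
    then set_encode (insert 3 (set_decode (set_encode (set_decode s \<union> set_decode t))))
    else set_encode (set_decode s \<union> set_decode t))"
  by simp

text \<open>Each recursive call has a smaller formula code, and type arguments that are components
  or members of the old ones and hence no larger. So the packed argument decreases and is its own
  rank.\<close>

lemma Rec_mul [rec_intros]:
  assumes "Rec c" "Rec f" "Rec g" shows "Rec (\<lambda>x. mul (fdec (c x)) (f x) (g x))"
proof -
  define F where "F x = mul (fdec (pfst x)) (pfst (psnd x)) (psnd (psnd x))" for x
  have "Rec F"
  proof (rule Rec_wf[where r = "\<lambda>x. x"])
    define \<Phi> where "\<Phi> x T = (let c = pfst x; s = pfst (psnd x); t = psnd (psnd x) in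
      if pfst c = 0 then if 0 \<in> set_decode s \<and> 1 \<in> set_decode t
        then set_encode (insert 3 (set_decode (set_encode (set_decode s \<union> set_decode t))))
        else set_encode (set_decode s \<union> set_decode t)
      else if pfst c = 1 then lookup T (pair (psnd c) (pair s t))
      else if pfst c = 2 then pair (lookup T (pair (pfst (psnd c)) (pair (pfst s) (pfst t))))
        (lookup T (pair (psnd (psnd c)) (pair (psnd s) (psnd t))))
      else set_encode {lookup T (pair (psnd (psnd c)) (pair a b)) |a b.
        a \<in> set_decode s \<and> b \<in> set_decode t \<and> True})" for x T
    show "Rec (\<lambda>z. \<Phi> (pfst z) (psnd z))" unfolding \<Phi>_def Let_def by (intro rec_intros)
    fix x T assume look: "\<And>y. y < x \<Longrightarrow> lookup T y = F y"
    define c s t where "c = pfst x" and "s = pfst (psnd x)" and "t = psnd (psnd x)"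
    have look': "lookup T (pair c' (pair a b)) = mul (fdec c') a b" if "c' < c" "a \<le> s" "b \<le> t" for c' a b
      using look[of "pair c' (pair a b)"] that unfolding c_def s_def t_def F_def
      by (simp add: pair_less_left pair_le)
    have "{lookup T (pair (psnd (psnd c)) (pair a b)) |a b. a \<in> set_decode s \<and> b \<in> set_decode t} =
        {mul (fdec (psnd (psnd c))) a b |a b. a \<in> set_decode s \<and> b \<in> set_decode t}" if "0 < pfst c"
    proof -
      have "lookup T (pair (psnd (psnd c)) (pair a b)) = mul (fdec (psnd (psnd c))) a b"
        if "a \<in> set_decode s" "b \<in> set_decode t" for a b
        using look'[OF pfst_psnd_less(2)[OF \<open>0 < pfst c\<close>], of a b] that[THEN set_decode_less] by simp
      then show ?thesis by (intro Collect_cong ex_cong1) auto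
    qed
    \<comment> \<open>At an atom the product depends on \<open>s\<close> and \<open>t\<close> only,
      so \<open>At 0 0 0\<close> can stand for every atom.\<close>
    moreover have "mul (fdec c) s t = (if pfst c = 0 then mul (At 0 0 0) s t
      else if pfst c = 1 then mul (fdec (psnd c)) s t
      else if pfst c = 2 then pair (mul (fdec (pfst (psnd c))) (pfst s) (pfst t))
        (mul (fdec (psnd (psnd c))) (psnd s) (psnd t))
      else set_encode {mul (fdec (psnd (psnd c))) a b |a b. a \<in> set_decode s \<and> b \<in> set_decode t})"
      by (subst fdec.simps) simp
    ultimately show "F x = \<Phi> x T"
      unfolding F_def \<Phi>_def Let_def c_def[symmetric] s_def[symmetric] t_def[symmetric] mul_At
      by (simp add: look' psnd_less pfst_psnd_less pfst_le psnd_le)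
  qed (intro rec_intros, simp)
  moreover have "Rec (\<lambda>x. pair (c x) (pair (f x) (g x)))" using assms by (intro rec_intros)
  ultimately have "Rec (\<lambda>x. F (pair (c x) (pair (f x) (g x))))" by (rule Rec_comp)
  then show ?thesis by (simp add: F_def)
qed

lemma Rec_mulD [rec_intros]:
  assumes "Rec c" "Rec f" "Rec g" shows "Rec (\<lambda>x. mulD d (fdec (c x)) (f x) (g x))"
  unfolding mulD_def using assms by (cases d) (simp_all add: Rec_mul)

lemma Rec_omega [rec_intros]:
  assumes "Rec c" "Rec f" shows "Rec (\<lambda>x. omega d (fdec (c x)) (f x))"
proof -
  define F where "F x = omega d (fdec (pfst x)) (psnd x)" for x
  have "Rec F"
  proof (rule Rec_wf[where r = "\<lambda>x. x"])
    define \<Phi> where "\<Phi> x T = (let c = pfst x; e = psnd x in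
      if pfst c = 0 then e
      else if pfst c = 1 then lookup T (pair (psnd c) e)
      else if pfst c = 2 then pair (lookup T (pair (pfst (psnd c)) (pfst e)))
        (lookup T (pair (psnd (psnd c)) (psnd e)))
      else set_encode {mulD d (fdec (psnd (psnd c))) s (lookup T (pair (psnd (psnd c)) f)) |s f.
        s \<in> set_decode e \<and> f \<in> set_decode e \<and> mul (fdec (psnd (psnd c))) f f = f})" for x T
    show "Rec (\<lambda>z. \<Phi> (pfst z) (psnd z))" unfolding \<Phi>_def Let_def by (intro rec_intros)
    fix x T assume look: "\<And>y. y < x \<Longrightarrow> lookup T y = F y"
    define c e where "c = pfst x" and "e = psnd x"
    have look': "lookup T (pair c' a) = omega d (fdec c') a" if "c' < c" "a \<le> e" for c' a
      using look[of "pair c' a"] that unfolding c_def e_def F_def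
      by (simp add: pair_less_left)
    let ?c = "psnd (psnd c)"
    have "{mulD d (fdec ?c) s (lookup T (pair ?c f)) |s f.
        s \<in> set_decode e \<and> f \<in> set_decode e \<and> mul (fdec ?c) f f = f} =
        {mulD d (fdec ?c) s (omega d (fdec ?c) f) |s f.
        s \<in> set_decode e \<and> f \<in> set_decode e \<and> mul (fdec ?c) f f = f}" if "0 < pfst c"
    proof -
      have "lookup T (pair ?c f) = omega d (fdec ?c) f" if "f \<in> set_decode e" for f
        using look'[OF pfst_psnd_less(2)[OF \<open>0 < pfst c\<close>], of f] that[THEN set_decode_less] by simp
      then show ?thesis by (intro Collect_cong ex_cong1) auto
    qed
    moreover have "omega d (fdec c) e = (if pfst c = 0 then e
      else if pfst c = 1 then omega d (fdec (psnd c)) e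
      else if pfst c = 2 then pair (omega d (fdec (pfst (psnd c))) (pfst e))
        (omega d (fdec (psnd (psnd c))) (psnd e))
      else set_encode {mulD d (fdec ?c) s (omega d (fdec ?c) f) |s f.
        s \<in> set_decode e \<and> f \<in> set_decode e \<and> mul (fdec ?c) f f = f})"
      by (subst fdec.simps) simp
    ultimately show "F x = \<Phi> x T"
      unfolding F_def \<Phi>_def Let_def c_def[symmetric] e_def[symmetric]
      by (simp add: look' psnd_less pfst_psnd_less pfst_le psnd_le)
  qed (intro rec_intros, simp)
  moreover have "Rec (\<lambda>x. pair (c x) (f x))" using assms by (intro rec_intros)
  ultimately have "Rec (\<lambda>x. F (pair (c x) (f x)))" by (rule Rec_comp)
  then show ?thesis by (simp add: F_def)
qed

lemma RecP_accepts [rec_intros]: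
  assumes "Rec c" "Rec f" shows "RecP (\<lambda>x. accepts (fdec (c x)) (f x))"
proof -
  define F where "F x = (of_bool (accepts (fdec (pfst x)) (psnd x)) :: nat)" for x
  have "Rec F"
  proof (rule Rec_wf[where r = "\<lambda>x. x"])
    define Q where "Q x T = (let c = pfst x; t = psnd x in
      if pfst c = 0 then
        if pfst (psnd c) = 0 then of_bool (2 \<in> set_decode t)
        else if pfst (psnd c) = 1 then of_bool (2 \<in> set_decode t \<or> 3 \<in> set_decode t)
        else of_bool (2 \<in> set_decode t \<and> 3 \<notin> set_decode t)
      else if pfst c = 1 then of_bool (lookup T (pair (psnd c) t) = 0)
      else if pfst c = 2 then of_bool (lookup T (pair (pfst (psnd c)) (pfst t)) = 1 \<and>
        lookup T (pair (psnd (psnd c)) (psnd t)) = 1)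
      else of_bool (\<exists>s\<in>set_decode t. lookup T (pair (psnd (psnd c)) s) = 1) :: nat)" for x T
    show "Rec (\<lambda>z. Q (pfst z) (psnd z))"
      unfolding Q_def Let_def by (intro rec_intros; fold RecP_def; intro rec_intros)
    fix x T assume look: "\<And>y. y < x \<Longrightarrow> lookup T y = F y"
    define c t where "c = pfst x" and "t = psnd x"
    have look': "lookup T (pair c' a) = of_bool (accepts (fdec c') a)" if "c' < c" "a \<le> t" for c' a
      using look[of "pair c' a"] that unfolding c_def t_def F_def
      by (simp add: pair_less_left)
    let ?c = "psnd (psnd c)"
    have "(\<exists>s\<in>set_decode t. lookup T (pair ?c s) = 1) \<longleftrightarrow> (\<exists>s\<in>set_decode t. accepts (fdec ?c) s)"
      if "0 < pfst c"
    proof (intro bex_cong refl)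
      fix s assume "s \<in> set_decode t"
      then show "lookup T (pair ?c s) = 1 \<longleftrightarrow> accepts (fdec ?c) s"
        using look'[OF pfst_psnd_less(2)[OF that]] set_decode_less[of s t] by simp
    qed
    moreover have "accepts (fdec c) t \<longleftrightarrow> (if pfst c = 0 then accepts (At (pfst (psnd c)) 0 0) t
      else if pfst c = 1 then \<not> accepts (fdec (psnd c)) t
      else if pfst c = 2 then accepts (fdec (pfst (psnd c))) (pfst t) \<and> accepts (fdec ?c) (psnd t)
      else \<exists>s\<in>set_decode t. accepts (fdec ?c) s)"
      by (subst fdec.simps) simp
    ultimately show "F x = Q x T"
      unfolding F_def Q_def Let_def c_def[symmetric] t_def[symmetric]
      by (simp add: look' psnd_less pfst_psnd_less pfst_le psnd_le)
  qed (intro rec_intros, simp)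
  moreover have "Rec (\<lambda>x. pair (c x) (f x))" using assms by (intro rec_intros)
  ultimately have "Rec (\<lambda>x. F (pair (c x) (f x)))" by (rule Rec_comp)
  then show ?thesis by (simp add: F_def RecP_def)
qed

lemma ptype_At: "ptype (At k i j) U =
    (if i \<in> U then 1 else 0) + (if j \<in> U then 2 else 0) + (if i \<in> U \<and> j \<in> U then 4 else 0)"
  by (auto simp: set_encode_def)

lemma set_encode_pair: "set_encode {a, b} = (if a = b then 2 ^ a else 2 ^ a + 2 ^ b)"
  by (simp add: set_encode_def)

lemma set_encode_mono: "finite B \<Longrightarrow> A \<subseteq> B \<Longrightarrow> set_encode A \<le> set_encode B"
  unfolding set_encode_def by (rule sum_mono2) auto

text \<open>Along the recursive calls of \<open>ptype\<close> the code of the set may grow, but only by a power of two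
  whose exponent is below the code of the formula; this is what the rank absorbs.\<close>

lemma Rec_ptype [rec_intros]:
  assumes "Rec c" "Rec f" shows "Rec (\<lambda>x. ptype (fdec (c x)) (set_decode (f x)))"
proof -
  define F where "F x = ptype (fdec (pfst x)) (set_decode (psnd x))" for x
  define r where "r x = pair (pfst x) (psnd x + 2 ^ Suc (pfst x))" for x
  have "Rec F"
  proof (rule Rec_wf[where r = r])
    show "Rec r" unfolding r_def by (intro rec_intros)
    show "y \<le> r y" for y using pair_mono[of "pfst y" "pfst y" "psnd y"] unfolding r_def by simp
    define \<Phi> where "\<Phi> x T = (let c = pfst x; u = psnd x; i = pfst (psnd c);
        p = pfst (psnd (psnd c)); q = psnd (psnd (psnd c));
        a = lookup T (pair (psnd (psnd c)) (set_encode (set_decode u - {i})));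
        b = lookup T (pair (psnd (psnd c)) (set_encode (insert i (set_decode u)))) in
      if pfst c = 0 then (if p \<in> set_decode u then 1 else 0) + (if q \<in> set_decode u then 2 else 0) +
        (if p \<in> set_decode u \<and> q \<in> set_decode u then 4 else 0)
      else if pfst c = 1 then lookup T (pair (psnd c) u)
      else if pfst c = 2 then pair (lookup T (pair (pfst (psnd c)) u)) (lookup T (pair (psnd (psnd c)) u))
      else if a = b then 2 ^ a else 2 ^ a + 2 ^ b)" for x T
    show "Rec (\<lambda>z. \<Phi> (pfst z) (psnd z))" unfolding \<Phi>_def Let_def by (intro rec_intros)
    fix x T assume look: "\<And>y. r y < r x \<Longrightarrow> lookup T y = F y"
    define c u where "c = pfst x" and "u = psnd x"
    have look': "lookup T (pair c' a) = ptype (fdec c') (set_decode a)" if "c' < c" "a \<le> u + 2 ^ c" for c' a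
    proof -
      have "a + 2 ^ Suc c' \<le> u + 2 ^ c + 2 ^ c"
        using that power_increasing[of "Suc c'" c "2::nat"] by simp
      then have "r (pair c' a) < r x"
        unfolding r_def using that(1) by (intro pair_less) (simp_all add: c_def u_def)
      then show ?thesis using look unfolding F_def by simp
    qed
    let ?c = "psnd (psnd c)" and ?i = "pfst (psnd c)"
    have "set_encode (set_decode u - {?i}) \<le> u + 2 ^ c"
      using set_encode_mono[of "set_decode u" "set_decode u - {?i}"] by simp
    moreover have "set_encode (insert ?i (set_decode u)) \<le> u + 2 ^ c" if "0 < pfst c"
    proof (cases "?i \<in> set_decode u")
      case False
      have "2 ^ ?i \<le> (2::nat) ^ c" using pfst_psnd_less(1)[OF that] by (intro power_increasing) auto
      then show ?thesis using False by simp
    qed (simp add: insert_absorb)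
    moreover have "ptype (fdec c) (set_decode u) = (if pfst c = 0 then
        ptype (At 0 (pfst (psnd (psnd c))) (psnd (psnd (psnd c)))) (set_decode u)
      else if pfst c = 1 then ptype (fdec (psnd c)) (set_decode u)
      else if pfst c = 2 then pair (ptype (fdec (pfst (psnd c))) (set_decode u)) (ptype (fdec ?c) (set_decode u))
      else set_encode {ptype (fdec ?c) (set_decode u - {?i}), ptype (fdec ?c) (insert ?i (set_decode u))})"
      by (subst fdec.simps) simp
    ultimately show "F x = \<Phi> x T"
      unfolding F_def \<Phi>_def Let_def c_def[symmetric] u_def[symmetric] ptype_At set_encode_pair
      by (simp add: look' psnd_less pfst_psnd_less)
  qed
  moreover have "Rec (\<lambda>x. pair (c x) (f x))" using assms by (intro rec_intros)
  ultimately have "Rec (\<lambda>x. F (pair (c x) (f x)))" by (rule Rec_comp)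
  then show ?thesis by (simp add: F_def)
qed

text \<open>The code of a finite set is monotone in the set, so the least code of a set closed under the
  generating operations is the code of the generated set.\<close>

lemma Rec_wtypes [rec_intros]:
  assumes "Rec c" shows "Rec (\<lambda>x. set_encode (wtypes (fdec (c x))))"
proof -
  define closed where "closed X \<phi> \<longleftrightarrow> letter \<phi> True \<in> set_decode X \<and> letter \<phi> False \<in> set_decode X \<and>
    (\<forall>s\<in>set_decode X. mul \<phi> s (letter \<phi> True) \<in> set_decode X \<and> mul \<phi> s (letter \<phi> False) \<in> set_decode X)"
    for X \<phi>
  have closed_wtypes: "closed (set_encode (wtypes \<phi>)) \<phi>" for \<phi>
    unfolding closed_def by (simp add: finite_wtypes wtypes.intros)
  have "(LEAST X. closed X \<phi>) = set_encode (wtypes \<phi>)" for \<phi>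
  proof (rule Least_equality[where P = "\<lambda>X. closed X \<phi>", OF closed_wtypes])
    fix X assume X: "closed X \<phi>"
    have "s \<in> set_decode X" if "s \<in> wtypes \<phi>" for s
      using that
    proof (induction s rule: wtypes.induct)
      case (letter b)
      then show ?case using X unfolding closed_def by (cases b) auto
    next
      case (snoc s b)
      then show ?case using X unfolding closed_def by (cases b) auto
    qed
    then show "set_encode (wtypes \<phi>) \<le> X"
      by (intro subset_decode_imp_le) (auto simp: finite_wtypes)
  qed
  moreover have "Rec (\<lambda>x. LEAST X. closed X (fdec (c x)))"
  proof (rule Rec_Least)
    have "letter \<phi> True = ptype \<phi> (set_decode 1)" "letter \<phi> False = ptype \<phi> (set_decode 0)" for \<phi>
      using set_encode_inverse[of "{0}"] by (simp_all add: letter_def del: set_encode_inverse)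
    then show "RecP (\<lambda>z. closed (pfst z) (fdec (c (psnd z))))"
      unfolding closed_def by (simp only:) (intro rec_intros Rec_comp[OF assms])
    show "\<exists>X. closed X (fdec (c x))" for x using closed_wtypes by blast
  qed
  ultimately show ?thesis by simp
qed

lemma Rec_rich_value [rec_intros]:
  assumes "Rec c" shows "Rec (\<lambda>x. rich_value (fdec (c x)))"
proof -
  have "right_minimal \<phi> e \<longleftrightarrow> e \<in> set_decode (set_encode (wtypes \<phi>)) \<and> mul \<phi> e e = e \<and>
      (\<forall>t\<in>set_decode (set_encode (wtypes \<phi>)). \<exists>y\<in>set_decode (set_encode (wtypes \<phi>)). mul \<phi> (mul \<phi> e t) y = e)" for \<phi> e
    by (simp add: right_minimal_def finite_wtypes)
  then have "RecP (\<lambda>z. right_minimal (fdec (c (psnd z))) (pfst z))"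
    by (simp only:) (intro rec_intros Rec_comp[OF assms])
  then have e: "Rec (\<lambda>x. LEAST e. right_minimal (fdec (c x)) e)"
    by (rule Rec_Least) (rule right_minimal_exists)
  show ?thesis unfolding rich_value_def Let_def by (intro Rec_mul Rec_omega e assms)
qed

lemma recursive_set_iff: "recursive_set A \<longleftrightarrow> RecP (\<lambda>n. n \<in> A)"
  unfolding recursive_set_def RecP_def Rec_iff by (simp add: of_bool_def)

theorem decidable_MTh_rich:
  assumes "rich (\<xi> -` {True})" shows "decidable_MTh \<xi>"
proof -
  let ?c = "\<lambda>n. fcode (core (dec n))"
  \<comment> \<open>The type to be tested is common to all rich words and computed from the formula;
    the word itself does not enter the computation.\<close>
  have "n \<in> code ` MTh \<xi> \<longleftrightarrow> code (dec n) = n \<and> (\<forall>k\<in>set_decode (set_encode (free_vars (fdec (?c n)))). k = 0) \<and>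
      accepts (fdec (?c n)) (rich_value (fdec (?c n)))" for n
    unfolding MTh_rich[OF assms] by (auto simp: sentence_core image_iff)
  moreover have "RecP (\<lambda>n. code (dec n) = n \<and> (\<forall>k\<in>set_decode (set_encode (free_vars (fdec (?c n)))). k = 0) \<and>
      accepts (fdec (?c n)) (rich_value (fdec (?c n))))"
    by (intro rec_intros Rec_code_dec Rec_core Rec_comp[OF Rec_free])
  ultimately show ?thesis unfolding decidable_MTh_def recursive_set_iff by (simp only:)
qed

section \<open>Rich words in every nontrivial m-degree\<close>

lemma many_one_reducible_iff: "A \<le>\<^sub>m B \<longleftrightarrow> (\<exists>f. Rec f \<and> (\<forall>n. n \<in> A \<longleftrightarrow> f n \<in> B))"
proof
  assume "A \<le>\<^sub>m B"
  then obtain g where g: "recursive 1 g" "\<And>n. n \<in> A \<longleftrightarrow> g [n] \<in> B"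
    unfolding many_one_reducible_def by blast
  then have "Rec (\<lambda>n. g [n])" unfolding Rec_iff by blast
  then show "\<exists>f. Rec f \<and> (\<forall>n. n \<in> A \<longleftrightarrow> f n \<in> B)" using g(2) by blast
next
  assume "\<exists>f. Rec f \<and> (\<forall>n. n \<in> A \<longleftrightarrow> f n \<in> B)"
  then obtain f where f: "Rec f" "\<And>n. n \<in> A \<longleftrightarrow> f n \<in> B" by blast
  from f(1) obtain g where "recursive 1 g" "\<And>x. g [x] = f x" unfolding Rec_iff by blast
  then show "A \<le>\<^sub>m B" unfolding many_one_reducible_def using f(2) by auto
qed

text \<open>The diagonals of Cantor's pairing are blocks of increasing length: the \<open>k\<close>-th one consists of the
  codes of \<open>(m, k - m)\<close> for \<open>m \<le> k\<close>. Its last position carries a bit of \<open>A\<close>; the others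
  spell out a finite word given by the first component of \<open>k\<close>.\<close>

definition beta :: "nat set \<Rightarrow> nat \<Rightarrow> bool" where
  "beta A n \<longleftrightarrow> (if psnd n = 0 then pfst n - 1 \<in> A else pfst n \<in> set_decode (pfst (pfst n + psnd n)))"

text \<open>The first component of \<open>k\<close> prescribes the word, the second makes
  \<open>k\<close> large: the diagonal then starts beyond \<open>N\<close>, and the word ends before
  its last position, the one that carries a bit of \<open>A\<close>.\<close>

lemma beta_word: "\<exists>b\<ge>N. \<forall>j<length w. beta A (b + j) \<longleftrightarrow> w ! j"
proof -
  let ?X = "{m. m < length w \<and> w ! m}"
  define k where "k = pair (set_encode ?X) (N + length w)"
  have k: "N + length w \<le> k" unfolding k_def by (rule le_prod_encode_2)
  have "beta A (triangle k + j) \<longleftrightarrow> w ! j" if "j < length w" for j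
  proof -
    have "triangle k + j = pair j (k - j)" using that k by (simp add: prod_encode_def)
    then show ?thesis using that k by (simp add: beta_def k_def)
  qed
  moreover have "k \<le> triangle k" by (induction k) auto
  ultimately show ?thesis using k by (intro exI[of _ "triangle k"]) auto
qed

text \<open>The same sequence is read outwards in both directions, so that each half carries all
  bits of \<open>A\<close>.\<close>

definition xi :: "nat set \<Rightarrow> biword" where
  "xi A i = beta A (nat \<bar>i\<bar>)"

lemma rich_xi: "rich (xi A -` {True})"
  unfolding rich_def
proof (intro allI conjI)
  fix w :: "bool list" and n :: int
  obtain b where b: "nat \<bar>n\<bar> \<le> b" "\<And>j. j < length w \<Longrightarrow> beta A (b + j) \<longleftrightarrow> w ! j"
    using beta_word by blast
  have "occurs w (xi A -` {True}) (int b)"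
    unfolding occurs_def xi_def using b(2) by (simp add: nat_add_distrib flip: of_nat_add)
  then show "\<exists>a\<ge>n. occurs w (xi A -` {True}) a" using b(1) by (intro exI[of _ "int b"]) linarith
next
  fix w :: "bool list" and n :: int
  \<comment> \<open>To the left the sequence runs backwards, so the reversed word is sought and
    \<open>a\<close> is the mirror image of its last position; \<open>+ 1\<close> ensures
    \<open>a \<le> n\<close> even for the empty word.\<close>
  obtain b where b: "nat \<bar>n\<bar> + 1 \<le> b" "\<And>j. j < length w \<Longrightarrow> beta A (b + j) \<longleftrightarrow> rev w ! j"
    using beta_word[of "nat \<bar>n\<bar> + 1" "rev w" A] unfolding length_rev by blast
  define a where "a = 1 - int (b + length w)"
  have "occurs w (xi A -` {True}) a"
    unfolding occurs_def
  proof (intro allI impI)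
    fix j assume j: "j < length w"
    have "nat \<bar>a + int j\<bar> = b + (length w - Suc j)" unfolding a_def using j b(1) by linarith
    then show "a + int j \<in> xi A -` {True} \<longleftrightarrow> w ! j"
      using b(2)[of "length w - Suc j"] j by (simp add: xi_def rev_nth)
  qed
  moreover have "a \<le> n" unfolding a_def using b(1) by linarith
  ultimately show "\<exists>a\<le>n. occurs w (xi A -` {True}) a" by blast
qed

text \<open>All three sets of factors consist of all finite words.\<close>

lemma recurrent_rich:
  assumes "rich (\<xi> -` {True})" shows "recurrent \<xi>"
proof -
  have occ: "w \<in> factors \<xi> I" if "occurs w (\<xi> -` {True}) a" "{a..a + int (length w) - 1} \<subseteq> I" for w a I
  proof (cases "w = []")
    case False
    let ?b = "a + int (length w) - 1"
    have "w = map \<xi> [a..?b]"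
      using that(1) by (intro nth_equalityI) (auto simp: occurs_def)
    moreover have "a \<le> ?b" using False by (cases w) auto
    ultimately show ?thesis using that(2) unfolding factors_def by blast
  qed (simp add: factors_def)
  have "w \<in> factors \<xi> {i..}" for w i
  proof -
    obtain a where "a \<ge> i" "occurs w (\<xi> -` {True}) a" using assms unfolding rich_def by blast
    then show ?thesis by (intro occ) auto
  qed
  moreover have "w \<in> factors \<xi> {..i}" for w i
  proof -
    obtain a where "a \<le> i - int (length w)" "occurs w (\<xi> -` {True}) a"
      using assms unfolding rich_def by blast
    then show ?thesis by (intro occ) auto
  qed
  moreover have "w \<in> factors \<xi> UNIV" for w
  proof -
    obtain a where "occurs w (\<xi> -` {True}) a" using assms unfolding rich_def by blast
    then show ?thesis by (intro occ) auto
  qed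
  ultimately show ?thesis unfolding recurrent_def by blast
qed

lemma right_set_xi: "n \<in> right_set (xi A) \<longleftrightarrow> beta A n"
  by (simp add: right_set_def xi_def)

lemma left_set_xi: "n \<in> left_set (xi A) \<longleftrightarrow> 0 < n \<and> beta A n"
proof -
  have "n \<in> left_set (xi A) \<longleftrightarrow> (\<exists>i\<le>-1. n = nat (- i) \<and> xi A i)" unfolding left_set_def by blast
  also have "\<dots> \<longleftrightarrow> 0 < n \<and> beta A n"
    by (auto simp: xi_def intro!: exI[of _ "- int n"])
  finally show ?thesis .
qed

lemma biword_set_xi: "n \<in> biword_set (xi A) \<longleftrightarrow> n \<noteq> 1 \<and> beta A (n div 2)"
proof -
  have "n \<in> biword_set (xi A) \<longleftrightarrow> (\<exists>i. n = 2 * i \<and> beta A i) \<or> (\<exists>i>0. n = 2 * i + 1 \<and> beta A i)"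
    unfolding biword_set_def xi_def by auto
  also have "\<dots> \<longleftrightarrow> n \<noteq> 1 \<and> beta A (n div 2)"
  proof (cases "even n")
    case True
    then show ?thesis by (auto elim!: evenE)
  next
    case False
    then obtain k where "n = 2 * k + 1" by (elim oddE)
    then show ?thesis by (auto; presburger)
  qed
  finally show ?thesis .
qed

text \<open>Positions that carry a bit of \<open>A\<close> are translated into that question.
  Everywhere else the answer is decidable and is expressed by a fixed element inside or outside
  \<open>A\<close>; this is where nontriviality enters.\<close>

lemma reducible_beta:
  assumes "RecP Q" "Rec h" and A: "A \<noteq> {}" "A \<noteq> UNIV"
  shows "{n. Q n \<and> beta A (h n)} \<le>\<^sub>m A"
proof -
  obtain a1 a0 where a: "a1 \<in> A" "a0 \<notin> A" using A by blast
  let ?f = "\<lambda>n. if Q n then if psnd (h n) = 0 then pfst (h n) - 1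
    else if pfst (h n) \<in> set_decode (pfst (pfst (h n) + psnd (h n))) then a1 else a0 else a0"
  have "Rec ?f" using assms(1,2) by (intro rec_intros)
  then show ?thesis
    unfolding many_one_reducible_iff using a by (intro exI[of _ ?f]) (auto simp: beta_def)
qed

text \<open>The shift by one keeps the slot away from position 0, which the left half does not
  contain.\<close>

lemma beta_slot: "beta A (pair (Suc n) 0) \<longleftrightarrow> n \<in> A"
  by (simp add: beta_def)

lemma xi_degrees:
  assumes "A \<noteq> {}" "A \<noteq> UNIV"
  shows "(A, biword_set (xi A)) \<in> many_one_equiv"
    and "(A, left_set (xi A)) \<in> many_one_equiv"
    and "(A, right_set (xi A)) \<in> many_one_equiv"
proof -
  have pos: "0 < pair (Suc n) 0" for n using le_prod_encode_1[of "Suc n" 0] by simp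
  have "A \<le>\<^sub>m biword_set (xi A)"
    unfolding many_one_reducible_iff
  proof (intro exI conjI allI)
    show "Rec (\<lambda>n. pair (Suc n) 0 + pair (Suc n) 0)" by (intro rec_intros)
    show "n \<in> A \<longleftrightarrow> pair (Suc n) 0 + pair (Suc n) 0 \<in> biword_set (xi A)" for n
      using beta_slot[of A n] by (simp add: biword_set_xi mult_2[symmetric])
  qed
  moreover have "A \<le>\<^sub>m left_set (xi A)" "A \<le>\<^sub>m right_set (xi A)"
    unfolding many_one_reducible_iff
    by (intro exI[of _ "\<lambda>n. pair (Suc n) 0"] conjI allI rec_intros;
      use pos beta_slot in \<open>simp add: left_set_xi right_set_xi\<close>)+
  moreover have "biword_set (xi A) = {n. n \<noteq> 1 \<and> beta A (n div 2)}"
    "left_set (xi A) = {n. 0 < n \<and> beta A n}" "right_set (xi A) = {n. True \<and> beta A n}"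
    using biword_set_xi left_set_xi right_set_xi by auto
  then have "biword_set (xi A) \<le>\<^sub>m A" "left_set (xi A) \<le>\<^sub>m A" "right_set (xi A) \<le>\<^sub>m A"
    using assms by (simp_all only:) (intro reducible_beta rec_intros; assumption)+
  ultimately show "(A, biword_set (xi A)) \<in> many_one_equiv" "(A, left_set (xi A)) \<in> many_one_equiv"
    "(A, right_set (xi A)) \<in> many_one_equiv"
    unfolding many_one_equiv_def by auto
qed

text \<open>Only the empty set reduces to the empty set, and only the full set to the full set, so
  the excluded classes are exactly the degrees of these two sets.\<close>

lemma nontrivial_m_degreeE:
  assumes "nontrivial_m_degree a"
  obtains A where "a = many_one_equiv `` {A}" "A \<noteq> {}" "A \<noteq> UNIV"
proof -
  obtain A where A: "a = many_one_equiv `` {A}"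
    using assms unfolding nontrivial_m_degree_def m_degrees_def by (auto elim: quotientE)
  have "many_one_equiv `` {{}} = {{}}" "many_one_equiv `` {UNIV} = {UNIV}"
    using many_one_reducible_refl[of "{}"] many_one_reducible_refl[of UNIV]
    unfolding many_one_equiv_def many_one_reducible_def by auto
  then have "A \<noteq> {}" "A \<noteq> UNIV" using assms A unfolding nontrivial_m_degree_def by auto
  with A show thesis by (rule that)
qed

theorem theorem5p4:
  "\<exists>\<xi> :: biword. recursive_biword \<xi> \<and> recurrent \<xi> \<and> decidable_MTh \<xi> \<and>
    (\<forall>a. nontrivial_m_degree a \<longrightarrow>
      (\<exists>\<xi>a :: biword. biword_set \<xi>a \<in> a \<and> MTh \<xi> = MTh \<xi>a \<and>
        left_set \<xi>a \<in> a \<and> right_set \<xi>a \<in> a))"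
proof (rule exI[of _ "xi {0}"], intro conjI allI impI)
  \<comment> \<open>Any recursive set other than \<open>{}\<close> and \<open>UNIV\<close> would do
    in place of \<open>{0}\<close>; the word inherits recursiveness through the reduction to
    it.\<close>
  have "biword_set (xi {0}) \<le>\<^sub>m {0}" using xi_degrees(1)[of "{0}"] unfolding many_one_equiv_def by auto
  then obtain f where f: "Rec f" "\<And>n. n \<in> biword_set (xi {0}) \<longleftrightarrow> f n = 0"
    unfolding many_one_reducible_iff by auto
  then show "recursive_biword (xi {0})"
    unfolding recursive_biword_def recursive_set_iff by (simp only: RecP_eq0)
next
  show "recurrent (xi {0})" by (rule recurrent_rich[OF rich_xi])
next
  show "decidable_MTh (xi {0})" by (rule decidable_MTh_rich[OF rich_xi])
next
  fix a :: "nat set set" assume "nontrivial_m_degree a"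
  then obtain A where A: "a = many_one_equiv `` {A}" "A \<noteq> {}" "A \<noteq> UNIV"
    by (rule nontrivial_m_degreeE)
  have "MTh (xi {0}) = MTh (xi A)" unfolding MTh_rich[OF rich_xi] ..
  then show "\<exists>\<xi>a. biword_set \<xi>a \<in> a \<and> MTh (xi {0}) = MTh \<xi>a \<and> left_set \<xi>a \<in> a \<and> right_set \<xi>a \<in> a"
    using xi_degrees[OF A(2,3)] unfolding A(1) by blast
qed

end
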